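(* Let $m\ge1$ and $0<h<2$, and let $P\in\mathfrak{P}_m(\Gamma)$ satisfy $\mathrm{mes}\{t\in\mathbb{T}:|P(e^{it})|\ge h\}=\delta_m(h)$. Then the set $\{t\in\mathbb{T}:|P(e^{it})|\ge h\}$ consists of one (nondegenerate) segment and $m-1$ isolated points.
   Context: $\Gamma$ is the unit circle of $\mathbb{C}$; $\mathfrak{P}_m(\Gamma)$ is the set of polynomials $P(z)=\prod_{j=1}^m(z-e^{i\phi_j})$, $\phi_j\in\mathbb{R}$ (monic, degree $m$, all zeros on $\Gamma$). $\mathbb{T}=[0,2\pi)$ with endpoints identified, with Lebesgue measure $\mathrm{mes}$. For $0\le h\le2$, $\delta_m(h)=\inf\{\mathrm{mes}\{t\in\mathbb{T}:|P(e^{it})|\ge h\}:P\in\mathfrak{P}_m(\Gamma)\}$. *)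

theory Defs
  imports "HOL-Analysis.Analysis" "HOL-Computational_Algebra.Polynomial"
begin

definition unit_circle_polys :: "nat \<Rightarrow> complex poly set" where
  "unit_circle_polys m = {(\<Prod>j<m. [:- cis (\<phi> j), 1:]) | \<phi> :: nat \<Rightarrow> real. True}"

text \<open>T = [0, 2 pi) (endpoints identified); the superlevel set of |P| on T.\<close>
definition superlevel :: "complex poly \<Rightarrow> real \<Rightarrow> real set" where
  "superlevel P h = {t \<in> {0..<2*pi}. cmod (poly P (cis t)) \<ge> h}"

definition delta :: "nat \<Rightarrow> real \<Rightarrow> real" where
  "delta m h = Inf ((\<lambda>P. measure lebesgue (superlevel P h)) ` unit_circle_polys m)"

definition circle_arc :: "real \<Rightarrow> real \<Rightarrow> real set" where
  "circle_arc a b = {t \<in> {0..<2*pi}. \<exists>k::int. a \<le> t + 2*pi*k \<and> t + 2*pi*k \<le> b}"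

end

theory Submission
  imports Defs "HOL-Complex_Analysis.Complex_Analysis"
    "HOL-Computational_Algebra.Fundamental_Theorem_Algebra"
begin

text \<open>Put E = {|P| \<ge> h}. If |P| < h on an arc joining two zeros of P, moving these two zeros apart
  symmetrically shrinks E; hence for an extremal P every one of the m arcs between adjacent zeros meets E,
  and does so in a segment [a, b], possibly a point. Let L be the measure of E. A polynomial of
  Chebyshev type shows 2 cos (L / 4)^m \<ge> h for the extremal P.

  Suppose that at least two segments are nondegenerate. Let R be the product of the quotients
  (z - e^{i a}) / (z - e^{i b}) over them, rotated to be real on the circle, \<zeta> = sqrt R, and let
  X = (\<zeta> + cnj (\<zeta> 0)) / (\<zeta> + \<zeta> 0). With a unimodular multiple p of P such that p^2 = z^m |P|^2 on the
  circle, put Z = p + sqrt (p^2 - h^2 z^m). The function Q = X^m Z is holomorphic in the disc, satisfies |Q| \<le> h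
  on the circle off E, and on the nondegenerate segments the radial derivative of ln |Q| is negative, by a strict
  Cauchy-Schwarz inequality for the partial fraction weights of R. So |Q| cannot have its maximum on E, and
  |Q 0| = 2 cos (L / 4)^m < h, a contradiction.\<close>

section \<open>Square roots of polynomials on the disc\<close>

text \<open>The property that every gap between zeros meets E is what makes Z holomorphic. The
  polynomial p^2 - h^2 z^m has degree at most 2m; for a level slightly below h, each gap supplies
  two zeros of the analogous polynomial on the circle, and none is left for the open disc. A
  limiting argument carries this to h, so the square root has a branch on the disc.

  On E no useful bound for |Z| is at hand; only its radial logarithmic derivative is known, and it
  is exactly m/2. A compensating factor is therefore wanted, of modulus at most 1 and with
  derivative below -m/2 on E. The function R provides it: its partial fraction weights are positive,
  so R maps the disc into the lower half-plane, \<zeta> maps it into the fourth quadrant, and there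
  the quotient X is bounded by 1. For a single arc the Cauchy-Schwarz inequality is an equality and
  the derivative for X is exactly -1/2; a second arc makes it strict.

  The angle L / 4 has two sources that must match: R 0 is \<open>cis (- L / 2)\<close>, and the
  square root halves the angle; the Chebyshev-type polynomial has its large values on one arc of
  length 4 arccos r with r^m = h / 2.\<close>

lemma continuous_on_csqrt_Re_nonneg: "continuous_on {w. 0 \<le> Re w} csqrt"
  unfolding continuous_on_eq_continuous_within
proof
  fix w :: complex assume w: "w \<in> {w. 0 \<le> Re w}"
  show "continuous (at w within {w. 0 \<le> Re w}) csqrt"
  proof (cases "w = 0")
    case True
    \<comment> \<open>The origin is the only point of the closed right half-plane on the branch cut
      of \<open>csqrt\<close>, and continuity there is seen from the modulus.\<close>
    have "((\<lambda>w. sqrt (cmod w)) \<longlongrightarrow> sqrt (cmod 0)) (at 0 within {w. 0 \<le> Re w})"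
      by (intro tendsto_intros)
    then have "((\<lambda>w. cmod (csqrt w)) \<longlongrightarrow> 0) (at 0 within {w. 0 \<le> Re w})"
      by (simp add: norm_csqrt)
    then have "(csqrt \<longlongrightarrow> 0) (at 0 within {w. 0 \<le> Re w})"
      by (rule tendsto_norm_zero_cancel)
    then show ?thesis using True
      by (simp add: continuous_within)
  next
    case False
    then have "w \<notin> \<real>\<^sub>\<le>\<^sub>0"
      using w by (auto simp: complex_nonpos_Reals_iff complex_eq_iff)
    then show ?thesis by (rule continuous_within_csqrt)
  qed
qed

definition disc_sqrt :: "complex poly \<Rightarrow> (complex \<Rightarrow> complex) \<Rightarrow> bool" where
  "disc_sqrt M s \<longleftrightarrow> (\<forall>z. (s z)\<^sup>2 = poly M z) \<and> continuous_on (cball 0 1) s \<and>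
     (\<forall>z\<in>cball 0 1. poly M z \<noteq> 0 \<longrightarrow> s field_differentiable at z)"

lemma disc_sqrt_mult:
  assumes "disc_sqrt M s" "disc_sqrt N t"
  shows "disc_sqrt (M * N) (\<lambda>z. s z * t z)"
  using assms unfolding disc_sqrt_def
  by (simp add: power_mult_distrib continuous_on_mult field_differentiable_mult)

lemma disc_sqrt_const: "disc_sqrt [:c:] (\<lambda>z. csqrt c)"
  unfolding disc_sqrt_def by auto

text \<open>After division by \<open>-x\<close> the factor becomes 1 - z / x, which maps the closed
  disc into the closed right half-plane; the principal branch therefore suffices.\<close>

lemma disc_sqrt_linear:
  assumes "1 \<le> cmod x"
  shows "\<exists>s. disc_sqrt [:-x, 1:] s"
proof -
  have x0: "x \<noteq> 0" using assms by auto
  have le: "cmod (z / x) \<le> 1" if "cmod z \<le> 1" for z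
    using that assms x0 by (simp add: norm_divide divide_simps)
  have re: "0 \<le> Re (1 - z / x)" if "cmod z \<le> 1" for z
    using le[OF that] complex_Re_le_cmod[of "z / x"] by simp
  have "disc_sqrt [:1, - 1 / x:] (\<lambda>z. csqrt (1 - z / x))"
    unfolding disc_sqrt_def
  proof (intro conjI allI ballI impI)
    show "continuous_on (cball 0 1) (\<lambda>z. csqrt (1 - z / x))"
      by (rule continuous_on_compose2[OF continuous_on_csqrt_Re_nonneg])
        (use x0 re in \<open>auto intro!: continuous_intros\<close>)
    fix z assume z: "z \<in> cball 0 1" and nz: "poly [:1, - 1 / x:] z \<noteq> 0"
    have "1 - z / x \<notin> \<real>\<^sub>\<le>\<^sub>0"
    proof
      assume "1 - z / x \<in> \<real>\<^sub>\<le>\<^sub>0"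
      with re[of z] z have "1 - z / x = 0"
        by (auto simp: complex_nonpos_Reals_iff complex_eq_iff)
      then show False using nz by simp
    qed
    then show "(\<lambda>z. csqrt (1 - z / x)) field_differentiable at z"
      unfolding field_differentiable_def
      by (auto intro!: exI derivative_eq_intros simp: x0)
  qed simp
  from disc_sqrt_mult[OF disc_sqrt_const[of "-x"] this] show ?thesis
    using x0 by (auto simp: field_simps)
qed

text \<open>Multiplying the branches of the linear factors gives continuity up to the circle at
  once, even at zeros on it. A logarithm on the open disc would leave the boundary behaviour
  open.\<close>

lemma disc_sqrt_exists:
  assumes "\<And>z. cmod z < 1 \<Longrightarrow> poly M z \<noteq> 0"
  shows "\<exists>s. disc_sqrt M s"
proof -
  have M0: "M \<noteq> 0" using assms[of 0] by auto
  obtain A where A: "M = smult (lead_coeff M) (\<Prod>x\<in>#A. [:-x, 1:])"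
    using alg_closed_imp_factorization[OF M0] by blast
  have root: "1 \<le> cmod x" if "x \<in># A" for x
  proof (rule ccontr)
    assume "\<not> 1 \<le> cmod x"
    moreover have "poly M x = 0"
    proof -
      have "[:-x, 1:] dvd (\<Prod>x\<in>#A. [:-x, 1:])"
        using that by (intro dvd_prod_mset) auto
      then have "[:-x, 1:] dvd M" using A dvd_smult by metis
      then show ?thesis by (simp add: poly_eq_0_iff_dvd)
    qed
    ultimately show False using assms[of x] by auto
  qed
  then have "\<exists>s. disc_sqrt (\<Prod>x\<in>#A. [:-x, 1:]) s"
  proof (induction A)
    case empty
    show ?case using disc_sqrt_const[of 1] by (auto simp: one_pCons)
  next
    case (add x A)
    then obtain s where "disc_sqrt (\<Prod>x\<in>#A. [:-x, 1:]) s" by auto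
    moreover obtain t where "disc_sqrt [:-x, 1:] t"
      using disc_sqrt_linear[of x] add.prems by auto
    ultimately show ?case using disc_sqrt_mult[of "[:-x, 1:]" t] by auto
  qed
  then obtain s where "disc_sqrt (\<Prod>x\<in>#A. [:-x, 1:]) s" by blast
  from disc_sqrt_mult[OF disc_sqrt_const[of "lead_coeff M"] this] show ?thesis
    using A by auto
qed

lemma disc_sqrt_exists_value:
  assumes "\<And>z. cmod z < 1 \<Longrightarrow> poly M z \<noteq> 0" and "v\<^sup>2 = poly M 0"
  shows "\<exists>s. disc_sqrt M s \<and> s 0 = v"
proof -
  obtain s where s: "disc_sqrt M s" using disc_sqrt_exists assms(1) by blast
  then have "(s 0)\<^sup>2 = v\<^sup>2" using assms(2) by (simp add: disc_sqrt_def)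
  then consider "s 0 = v" | "- s 0 = v" by (metis power2_eq_iff minus_minus)
  then show ?thesis
  proof cases
    case 2
    have "disc_sqrt M (\<lambda>z. - s z)"
      using s unfolding disc_sqrt_def
      by (auto intro!: continuous_intros field_differentiable_minus)
    with 2 show ?thesis by blast
  qed (use s in blast)
qed

lemma disc_sqrt_has_field_derivative:
  assumes "disc_sqrt M s" "cmod z \<le> 1" "poly M z \<noteq> 0"
  shows "(s has_field_derivative poly (pderiv M) z / (2 * s z)) (at z)"
proof -
  have sq: "(s w)\<^sup>2 = poly M w" for w using assms by (simp add: disc_sqrt_def)
  obtain d where d: "(s has_field_derivative d) (at z)"
    using assms unfolding disc_sqrt_def field_differentiable_def by auto
  have "((\<lambda>w. (s w)\<^sup>2) has_field_derivative 2 * s z * d) (at z)"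
    by (auto intro!: derivative_eq_intros d)
  moreover have "((\<lambda>w. (s w)\<^sup>2) has_field_derivative poly (pderiv M) z) (at z)"
    unfolding sq by (rule poly_DERIV)
  ultimately have "2 * s z * d = poly (pderiv M) z" by (rule DERIV_unique)
  moreover have "s z \<noteq> 0" using sq[of z] assms(3) by auto
  ultimately have "d = poly (pderiv M) z / (2 * s z)" by (simp add: field_simps)
  with d show ?thesis by simp
qed

lemma disc_sqrt_holomorphic:
  assumes "disc_sqrt M s" "\<And>z. cmod z < 1 \<Longrightarrow> poly M z \<noteq> 0"
  shows "s holomorphic_on ball 0 1"
  using assms unfolding disc_sqrt_def
  by (simp add: holomorphic_on_def field_differentiable_at_within)

section \<open>Partial fractions with simple poles\<close>

lemma partial_fraction_aux:
  fixes a d x y z :: "'a :: field"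
  assumes "x \<noteq> y" "z \<noteq> x" "z \<noteq> y"
  shows "d * ((x - a) / (x - y)) / (z - x) =
    d / (z - x) + (y - a) / (z - y) * (d / (z - x)) - (y - a) / (z - y) * (d / (y - x))"
proof -
  define u v c where "u = x - y" and "v = z - x" and "c = y - a"
  have eqs: "x - a = u + c" "x - y = u" "z - x = v" "z - y = u + v" "y - x = - u" "y - a = c"
    by (simp_all add: u_def v_def c_def)
  have nz: "u \<noteq> 0" "v \<noteq> 0" "u + v \<noteq> 0"
    using assms by (auto simp: u_def v_def)
  have e: "1 / (u * v) = 1 / (u + v) * (1 / v) + 1 / (u + v) * (1 / u)"
    using nz by (simp add: divide_simps)
  have "d * ((u + c) / u) / v = d / v + c * d * (1 / (u * v))"
    using nz by (simp add: field_simps)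
  also have "\<dots> = d / v + c / (u + v) * (d / v) - c / (u + v) * (d / (- u))"
    unfolding e by (simp add: distrib_left)
  finally show ?thesis unfolding eqs .
qed

text \<open>When a factor with pole \<open>e n\<close> is added, the new coefficient at
  \<open>e n\<close> is the old product evaluated at \<open>e n\<close>. The induction therefore
  needs the expansion at points other than the given \<open>z\<close>.\<close>

lemma partial_fractions:
  fixes e f :: "'i \<Rightarrow> 'a :: field"
  assumes "finite J" "inj_on e J" "z \<notin> e ` J"
  shows "(\<Prod>j\<in>J. (z - f j) / (z - e j)) =
    1 + (\<Sum>k\<in>J. (e k - f k) * (\<Prod>j\<in>J - {k}. (e k - f j) / (e k - e j)) / (z - e k))"
  using assms
proof (induction J arbitrary: z rule: finite_induct)
  case empty
  show ?case by simp
next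
  case (insert n J)
  define d where "d k = (e k - f k) * (\<Prod>j\<in>J - {k}. (e k - f j) / (e k - e j))" for k
  have IH: "(\<Prod>j\<in>J. (z - f j) / (z - e j)) = 1 + (\<Sum>k\<in>J. d k / (z - e k))"
    if "z \<notin> e ` J" for z
    using insert.IH[OF _ that] insert.prems(1) unfolding d_def by (auto simp: inj_on_insert)
  have en: "e n \<notin> e ` J" using insert.prems(1) insert.hyps(2) by auto
  have zn: "z \<noteq> e n" and zJ: "z \<notin> e ` J" using insert.prems(2) by auto
  have tn: "(\<Prod>j\<in>insert n J - {n}. (e n - f j) / (e n - e j)) = 1 + (\<Sum>k\<in>J. d k / (e n - e k))"
    using IH[OF en] insert.hyps by (simp add: insert_Diff_if)
  have tk: "(e k - f k) * (\<Prod>j\<in>insert n J - {k}. (e k - f j) / (e k - e j)) =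
      d k * ((e k - f n) / (e k - e n))" if "k \<in> J" for k
  proof -
    have "insert n J - {k} = insert n (J - {k})" using that insert.hyps by auto
    then show ?thesis using insert.hyps by (simp add: d_def)
  qed
  have split: "d k * ((e k - f n) / (e k - e n)) / (z - e k) =
     d k / (z - e k) + (e n - f n) / (z - e n) * (d k / (z - e k)) - (e n - f n) / (z - e n) * (d k / (e n - e k))"
    if "k \<in> J" for k
  proof -
    have "e k \<noteq> e n" "z \<noteq> e k" using that en zJ by (metis imageI)+
    with zn show ?thesis by (intro partial_fraction_aux)
  qed
  have "(\<Prod>j\<in>insert n J. (z - f j) / (z - e j)) =
     (1 + (e n - f n) / (z - e n)) * (1 + (\<Sum>k\<in>J. d k / (z - e k)))"
    using insert.hyps zn IH[OF zJ] by (simp add: field_simps)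
  also have "\<dots> = 1 + (e n - f n) * (1 + (\<Sum>k\<in>J. d k / (e n - e k))) / (z - e n) +
     (\<Sum>k\<in>J. d k * ((e k - f n) / (e k - e n)) / (z - e k))"
  proof -
    define c where "c = (e n - f n) / (z - e n)"
    have "(\<Sum>k\<in>J. d k * ((e k - f n) / (e k - e n)) / (z - e k)) =
      (\<Sum>k\<in>J. d k / (z - e k) + c * (d k / (z - e k)) - c * (d k / (e n - e k)))"
      by (rule sum.cong) (simp_all only: split c_def)
    also have "\<dots> = (\<Sum>k\<in>J. d k / (z - e k)) + c * (\<Sum>k\<in>J. d k / (z - e k)) - c * (\<Sum>k\<in>J. d k / (e n - e k))"
      by (simp only: sum.distrib sum_subtractf sum_distrib_left)
    finally show ?thesis
      unfolding c_def[symmetric] by (simp only: times_divide_eq_left[symmetric] c_def[symmetric]) (simp only: distrib_left distrib_right, simp)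
  qed
  also have "\<dots> = 1 + (\<Sum>k\<in>insert n J. (e k - f k) * (\<Prod>j\<in>insert n J - {k}. (e k - f j) / (e k - e j)) / (z - e k))"
    unfolding sum.insert[OF insert.hyps] tn
    by (simp only: tk add.assoc cong: sum.cong)
  finally show ?case .
qed

section \<open>A rational function attached to a system of arcs\<close>

lemma cis_diff: "cis x - cis y = 2 * \<i> * cis ((x + y) / 2) * of_real (sin ((x - y) / 2))"
proof -
  have x: "x = (x + y) / 2 + (x - y) / 2" and y: "y = (x + y) / 2 - (x - y) / 2"
    by (simp_all add: field_simps)
  show ?thesis
    by (subst x, subst (2) y)
      (simp add: complex_eq_iff cos_add cos_diff sin_add sin_diff)
qed

lemma cis_sum: "finite A \<Longrightarrow> cis (sum f A) = (\<Prod>x\<in>A. cis (f x))"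
  by (induction A rule: finite_induct) (simp_all add: cis_mult[symmetric])

lemma cis_diff_ratio:
  "(cis t - cis x) / (cis t - cis y) =
    cis ((x - y) / 2) * of_real (sin ((t - x) / 2) / sin ((t - y) / 2))"
proof -
  have "cis ((x - y) / 2) = cis ((t + x) / 2) / cis ((t + y) / 2)"
    by (simp add: cis_divide diff_divide_distrib[symmetric])
  then show ?thesis by (simp add: cis_diff)
qed

lemma sin_half_pos_iff: "\<bar>x\<bar> < 2 * pi \<Longrightarrow> 0 < sin (x / 2) \<longleftrightarrow> 0 < x"
  using sin_gt_zero[of "x / 2"] sin_gt_zero[of "- x / 2"] 
  by (cases "x = 0") (auto simp: abs_if split: if_splits)

lemma sin_half_neg_iff: "\<bar>x\<bar> < 2 * pi \<Longrightarrow> sin (x / 2) < 0 \<longleftrightarrow> x < 0"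
  using sin_half_pos_iff[of "- x"] by simp

lemma sin_half_ratio_pos:
  assumes "\<bar>x\<bar> < 2 * pi" "\<bar>y\<bar> < 2 * pi" "0 < x * y"
  shows "0 < sin (x / 2) / sin (y / 2)"
  using assms sin_half_pos_iff[of x] sin_half_pos_iff[of y] sin_half_neg_iff[of x] sin_half_neg_iff[of y]
  by (auto simp: zero_less_mult_iff zero_less_divide_iff)

lemma cis_inj_window:
  assumes "cis x = cis y" "\<bar>x - y\<bar> < 2 * pi"
  shows "x = y"
proof -
  have "sin ((x - y) / 2) = 0" using cis_diff[of x y] assms(1) by simp
  then show ?thesis
    using sin_half_pos_iff[OF assms(2)] sin_half_neg_iff[OF assms(2)] by linarith
qed

lemma mult_kernel_circle:
  assumes "cmod z = 1" "cmod w = 1"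
  shows "(z - w)\<^sup>2 = - z * w * of_real ((cmod (z - w))\<^sup>2)"
proof -
  have "z * cnj z = 1" "w * cnj w = 1"
    using assms by (simp_all add: complex_norm_square[symmetric])
  moreover have "of_real ((cmod (z - w))\<^sup>2) = (z - w) * (cnj z - cnj w)"
    by (simp only: complex_norm_square complex_cnj_diff)
  ultimately show ?thesis by algebra
qed

text \<open>The Herglotz kernel times an imaginary unit. For \<open>w\<close> on the circle its
  imaginary part in the disc is minus the Poisson kernel, and at z = \<open>cis t\<close>, w =
  \<open>cis s\<close> it is the real number cot ((t - s) / 2).\<close>

definition herglotz :: "complex \<Rightarrow> complex \<Rightarrow> complex" where
  "herglotz w z = \<i> * (z + w) / (z - w)"

lemma Im_herglotz: "Im (herglotz w z) = ((cmod z)\<^sup>2 - (cmod w)\<^sup>2) / (cmod (z - w))\<^sup>2"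
proof -
  have "herglotz w z = \<i> * ((z + w) * cnj (z - w)) / of_real ((cmod (z - w))\<^sup>2)"
    unfolding herglotz_def by (subst complex_div_cnj) simp
  then have "Im (herglotz w z) = Re ((z + w) * cnj (z - w)) / (cmod (z - w))\<^sup>2"
    by (simp only: Im_divide_of_real) simp
  then show ?thesis
    by (simp add: cmod_power2) (simp add: power2_eq_square algebra_simps)
qed

text \<open>On the circle this is 1 + cot^2 = 1 / sin^2. It turns the derivative of the kernel into
  its square, which is how second moments enter.\<close>

lemma one_plus_herglotz_sq:
  assumes "z \<noteq> w"
  shows "1 + (herglotz w z)\<^sup>2 = - 4 * z * w / (z - w)\<^sup>2"
proof -
  have "1 + (herglotz w z)\<^sup>2 = ((z - w)\<^sup>2 - (z + w)\<^sup>2) / (z - w)\<^sup>2"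
    using assms by (simp add: herglotz_def power_divide power_mult_distrib diff_divide_distrib)
  also have "(z - w)\<^sup>2 - (z + w)\<^sup>2 = - 4 * z * w" by algebra
  finally show ?thesis .
qed

lemma herglotz_inj:
  assumes "herglotz v z = herglotz w z" "z \<noteq> v" "z \<noteq> w" "z \<noteq> 0"
  shows "v = w"
proof -
  have "(z + v) * (z - w) = (z + w) * (z - v)"
    using assms(1-3) by (simp add: herglotz_def field_simps)
  then have "2 * z * (v - w) = 0" by algebra
  then show ?thesis using assms(4) by simp
qed

text \<open>All end points lie in one window shorter than a full turn. Differences of end points
  then determine the signs of the half-angle sines, and distinct end points stay distinct on the
  circle. The indices form a set because degenerate segments will be dropped from a list of
  m.\<close>

locale arc_system =
  fixes J :: "nat set" and a b :: "nat \<Rightarrow> real"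
  assumes fin: "finite J" and ne: "J \<noteq> {}"
    and ab: "j \<in> J \<Longrightarrow> a j < b j"
    and ord: "i \<in> J \<Longrightarrow> j \<in> J \<Longrightarrow> i < j \<Longrightarrow> b i < a j"
    and span: "i \<in> J \<Longrightarrow> j \<in> J \<Longrightarrow> b i - a j < 2 * pi"
    and len: "(\<Sum>j\<in>J. b j - a j) < 2 * pi"
begin

definition "L = (\<Sum>j\<in>J. b j - a j)"

text \<open>This is the residue of \<open>R\<close> at \<open>cis (b k)\<close> divided by 2 i
  \<open>cis (b k)\<close>, written so that its sign can be read off.\<close>

definition "wt k = sin ((b k - a k) / 2) * (\<Prod>j\<in>J - {k}. sin ((b k - a j) / 2) / sin ((b k - b j) / 2))"

definition "R z = cis (L / 2) * (\<Prod>j\<in>J. (z - cis (a j)) / (z - cis (b j)))"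

lemma L_pos: "0 < L"
  unfolding L_def using fin ne ab by (intro sum_pos) auto

lemma L_less: "L < 2 * pi"
  unfolding L_def by (rule len)

lemma sin_L_pos: "0 < sin (L / 2)"
  using L_pos L_less by (intro sin_gt_zero) auto

text \<open>Another arc lies entirely on one side of t, so both differences have the same sign. The
  right end is included since the weights are evaluated at \<open>b k\<close>.\<close>

lemma ratio_pos:
  assumes "k \<in> J" "j \<in> J" "j \<noteq> k" "a k < t" "t \<le> b k"
  shows "0 < sin ((t - a j) / 2) / sin ((t - b j) / 2)"
proof (rule sin_half_ratio_pos)
  consider "j < k" | "k < j" using assms by linarith
  then have "b j < a k \<or> b k < a j" using ord assms by metis
  moreover have "a j < b j" "a k < b k" "b k - a j < 2 * pi" "b j - a k < 2 * pi"
    using ab span assms by auto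
  ultimately show "\<bar>t - a j\<bar> < 2 * pi" "\<bar>t - b j\<bar> < 2 * pi" "0 < (t - a j) * (t - b j)"
    using assms by (auto simp: zero_less_mult_iff)
qed

lemma wt_pos:
  assumes "k \<in> J"
  shows "0 < wt k"
  unfolding wt_def
proof (intro mult_pos_pos prod_pos)
  show "0 < sin ((b k - a k) / 2)"
    using sin_half_pos_iff[of "b k - a k"] ab[OF assms] span[OF assms assms] by auto
  show "0 < sin ((b k - a j) / 2) / sin ((b k - b j) / 2)" if "j \<in> J - {k}" for j
    using ratio_pos[OF assms, of j "b k"] that ab[OF assms] by auto
qed

lemma inj_b: "inj_on (\<lambda>j. cis (b j)) J"
proof (rule inj_onI)
  fix i j assume ij: "i \<in> J" "j \<in> J" "cis (b i) = cis (b j)"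
  have "b i = b j"
    using cis_inj_window[OF ij(3)] span[OF ij(1,2)] span[OF ij(2,1)] ab[OF ij(1)] ab[OF ij(2)] by auto
  then show "i = j"
    using ord[OF ij(1,2)] ord[OF ij(2,1)] ab[OF ij(1)] ab[OF ij(2)] by (metis less_asym linorder_neqE_nat)
qed

lemma cis_a_neq_b:
  assumes "i \<in> J" "j \<in> J"
  shows "cis (a i) \<noteq> cis (b j)"
proof
  assume eq: "cis (a i) = cis (b j)"
  consider "i = j" | "i < j" | "j < i" by linarith
  then have "a i \<noteq> b j \<and> \<bar>a i - b j\<bar> < 2 * pi"
  proof cases
    case 1 then show ?thesis using ab[OF assms(1)] span[OF assms(2,1)] by auto
  next
    case 2 then show ?thesis
      using ord[OF assms 2] ab[OF assms(1)] ab[OF assms(2)] span[OF assms(2,1)] by auto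
  next
    case 3 then show ?thesis
      using ord[OF assms(2,1) 3] ab[OF assms(1)] ab[OF assms(2)] span[OF assms] by auto
  qed
  with cis_inj_window[OF eq] show False by auto
qed

lemma R_circle: "R (cis t) = of_real (\<Prod>j\<in>J. sin ((t - a j) / 2) / sin ((t - b j) / 2))"
proof -
  have "(\<Prod>j\<in>J. cis ((a j - b j) / 2)) = cis (- L / 2)"
    unfolding L_def cis_sum[OF fin, symmetric]
    by (simp add: sum_negf[symmetric] sum_divide_distrib)
  then have "(\<Prod>j\<in>J. (cis t - cis (a j)) / (cis t - cis (b j))) =
      cis (- L / 2) * of_real (\<Prod>j\<in>J. sin ((t - a j) / 2) / sin ((t - b j) / 2))"
    by (simp only: cis_diff_ratio prod.distrib of_real_prod)
  then show ?thesis
    unfolding R_def by (simp add: mult.assoc[symmetric] cis_mult)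
qed

lemma R_neg:
  assumes "k \<in> J" "a k < t" "t < b k"
  shows "\<exists>x<0. R (cis t) = of_real x"
proof -
  let ?f = "\<lambda>j. sin ((t - a j) / 2) / sin ((t - b j) / 2)"
  have "prod ?f J = ?f k * prod ?f (J - {k})"
    using fin assms(1) by (rule prod.remove)
  moreover have "0 < prod ?f (J - {k})"
    using ratio_pos[OF assms(1)] assms by (intro prod_pos) auto
  moreover have "?f k < 0"
    using sin_half_pos_iff[of "t - a k"] sin_half_neg_iff[of "t - b k"] assms span[OF assms(1,1)]
    by (auto simp: divide_less_0_iff)
  ultimately have "prod ?f J < 0" by (simp only: mult_neg_pos)
  then show ?thesis using R_circle by blast
qed

lemma residue_eq:
  assumes "k \<in> J"
  shows "cis (L / 2) * ((cis (b k) - cis (a k)) *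
    (\<Prod>j\<in>J - {k}. (cis (b k) - cis (a j)) / (cis (b k) - cis (b j)))) = 2 * \<i> * cis (b k) * of_real (wt k)"
proof -
  have "(\<Prod>j\<in>J. cis ((a j - b j) / 2)) = cis (- L / 2)"
    unfolding L_def cis_sum[OF fin, symmetric]
    by (simp add: sum_negf[symmetric] sum_divide_distrib)
  then have "cis ((a k - b k) / 2) * (\<Prod>j\<in>J - {k}. cis ((a j - b j) / 2)) = cis (- L / 2)"
    using prod.remove[OF fin assms, of "\<lambda>j. cis ((a j - b j) / 2)"] by simp
  moreover have "cis ((b k + a k) / 2) = cis (b k) * cis ((a k - b k) / 2)"
    by (simp add: cis_mult field_simps)
  ultimately have "cis (L / 2) * (cis ((b k + a k) / 2) * (\<Prod>j\<in>J - {k}. cis ((a j - b j) / 2))) =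
      cis (L / 2) * (cis (b k) * cis (- L / 2))"
    by (simp add: mult.assoc)
  also have "\<dots> = cis (b k)" by (simp add: cis_mult)
  finally have *: "cis (L / 2) * (cis ((b k + a k) / 2) * (\<Prod>j\<in>J - {k}. cis ((a j - b j) / 2))) = cis (b k)" .
  have "cis (L / 2) * ((cis (b k) - cis (a k)) *
    (\<Prod>j\<in>J - {k}. (cis (b k) - cis (a j)) / (cis (b k) - cis (b j)))) =
    2 * \<i> * (cis (L / 2) * (cis ((b k + a k) / 2) * (\<Prod>j\<in>J - {k}. cis ((a j - b j) / 2)))) * of_real (wt k)"
    unfolding cis_diff_ratio prod.distrib wt_def cis_diff[of "b k" "a k"] of_real_mult of_real_prod
    by (simp add: mult_ac)
  then show ?thesis unfolding * .
qed

lemma R_partial_fractions: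
  assumes "z \<notin> (\<lambda>j. cis (b j)) ` J"
  shows "R z = cis (L / 2) + (\<Sum>k\<in>J. 2 * \<i> * cis (b k) * of_real (wt k) / (z - cis (b k)))"
  unfolding R_def partial_fractions[OF fin inj_b assms]
  unfolding distrib_left sum_distrib_left times_divide_eq_right
  by (simp only: residue_eq mult_1_right cong: sum.cong)

lemma R_herglotz:
  assumes "z \<notin> (\<lambda>j. cis (b j)) ` J"
  shows "R z = cis (L / 2) - \<i> * of_real (\<Sum>k\<in>J. wt k) + (\<Sum>k\<in>J. of_real (wt k) * herglotz (cis (b k)) z)"
proof -
  have "2 * \<i> * cis (b k) * of_real (wt k) / (z - cis (b k)) =
      of_real (wt k) * herglotz (cis (b k)) z - \<i> * of_real (wt k)" if "k \<in> J" for k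
  proof -
    have "z - cis (b k) \<noteq> 0" using assms that by auto
    then show ?thesis unfolding herglotz_def by (simp add: field_simps)
  qed
  then show ?thesis
    unfolding R_partial_fractions[OF assms]
    by (simp add: sum_subtractf sum_distrib_left)
qed

text \<open>At a zero \<open>cis (a i)\<close> of \<open>R\<close> on the circle all kernels are
  real, so the imaginary part of the constant term must vanish.\<close>

lemma sum_wt: "(\<Sum>k\<in>J. wt k) = sin (L / 2)"
proof -
  obtain i where i: "i \<in> J" using ne by auto
  have np: "cis (a i) \<notin> (\<lambda>j. cis (b j)) ` J" using cis_a_neq_b i by auto
  have "R (cis (a i)) = 0"
    unfolding R_def using fin i by auto
  then have "Im (cis (L / 2) - \<i> * of_real (\<Sum>k\<in>J. wt k) + (\<Sum>k\<in>J. of_real (wt k) * herglotz (cis (b k)) (cis (a i)))) = 0"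
    using R_herglotz[OF np] by simp
  then show ?thesis by (simp add: Im_herglotz)
qed

lemma R_eq:
  assumes "z \<notin> (\<lambda>j. cis (b j)) ` J"
  shows "R z = of_real (cos (L / 2)) + (\<Sum>k\<in>J. of_real (wt k) * herglotz (cis (b k)) z)"
  unfolding R_herglotz[OF assms] sum_wt by (simp add: complex_eq_iff)

text \<open>In the disc the imaginary part is minus a sum of Poisson kernels with positive
  weights.\<close>

lemma Im_R_neg:
  assumes "cmod z < 1"
  shows "Im (R z) < 0"
proof -
  have np: "z \<notin> (\<lambda>j. cis (b j)) ` J" using assms by auto
  have "(\<Sum>k\<in>J. wt k * Im (herglotz (cis (b k)) z)) < (\<Sum>k\<in>J. 0)"
  proof (rule sum_strict_mono[OF fin ne])
    fix k assume "k \<in> J"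
    moreover have "Im (herglotz (cis (b k)) z) < 0"
    proof -
      have "z \<noteq> cis (b k)" using assms by auto
      then show ?thesis using assms
        by (simp add: Im_herglotz divide_less_0_iff abs_square_less_1)
    qed
    ultimately show "wt k * Im (herglotz (cis (b k)) z) < 0"
      using wt_pos by (simp add: mult_pos_neg)
  qed
  then show ?thesis by (simp add: R_eq[OF np])
qed

text \<open>All kernels equal -i at the origin. This value fixes the branch of the square root and
  is the origin of the angle L / 4.\<close>

lemma R_0: "R 0 = cis (- L / 2)"
proof -
  have np: "0 \<notin> (\<lambda>j. cis (b j)) ` J" by (auto simp: complex_eq_iff) (metis cis_neq_zero complex_eq_iff cis.sel zero_complex.sel)
  have "herglotz (cis (b k)) 0 = - \<i>" for k by (simp add: herglotz_def)
  then have "R 0 = of_real (cos (L / 2)) - \<i> * of_real (\<Sum>k\<in>J. wt k)"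
    unfolding R_eq[OF np] by (simp add: sum_negf sum_distrib_left mult.commute)
  then show ?thesis by (simp add: sum_wt complex_eq_iff)
qed

end

section \<open>Derivatives on the circle and the strict inequality\<close>

text \<open>The difference of the two sides is the total weight times the weighted sum of squares
  about the mean \<mu>; one of two different values must miss the mean.\<close>

lemma weighted_cauchy_schwarz_strict:
  fixes w c :: "'i \<Rightarrow> real"
  assumes "finite J" "\<And>k. k \<in> J \<Longrightarrow> 0 < w k" "i \<in> J" "j \<in> J" "c i \<noteq> c j"
  shows "(\<Sum>k\<in>J. w k * c k)\<^sup>2 < (\<Sum>k\<in>J. w k) * (\<Sum>k\<in>J. w k * (c k)\<^sup>2)"
proof -
  define W S Q where "W = (\<Sum>k\<in>J. w k)" and "S = (\<Sum>k\<in>J. w k * c k)" and "Q = (\<Sum>k\<in>J. w k * (c k)\<^sup>2)"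
  have W: "0 < W" unfolding W_def using assms by (intro sum_pos) auto
  define \<mu> where "\<mu> = S / W"
  obtain l where l: "l \<in> J" "c l \<noteq> \<mu>" using assms by metis
  have "0 < (\<Sum>k\<in>J. w k * (c k - \<mu>)\<^sup>2)"
  proof (rule sum_pos2[OF assms(1) l(1)])
    show "0 < w l * (c l - \<mu>)\<^sup>2" using assms(2) l by simp
    show "0 \<le> w i * (c i - \<mu>)\<^sup>2" if "i \<in> J" for i using assms(2)[OF that] by simp
  qed
  also have "\<dots> = Q - 2 * \<mu> * S + \<mu>\<^sup>2 * W"
    unfolding Q_def S_def W_def
    by (simp add: sum_distrib_left sum.distrib[symmetric] sum_subtractf[symmetric] power2_eq_square algebra_simps)
  finally have "0 < W * (Q - 2 * \<mu> * S + \<mu>\<^sup>2 * W)" using W by simp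
  also have "\<dots> = W * Q - 2 * (\<mu> * W) * S + (\<mu> * W)\<^sup>2"
    by (simp add: power2_eq_square algebra_simps)
  also have "\<mu> * W = S" using W by (simp add: \<mu>_def)
  also have "W * Q - 2 * S * S + S\<^sup>2 = W * Q - S\<^sup>2" by (simp add: power2_eq_square)
  finally show ?thesis by (simp add: W_def S_def Q_def)
qed

lemma herglotz_DERIV:
  "z \<noteq> w \<Longrightarrow> (herglotz w has_field_derivative - 2 * \<i> * w / (z - w)\<^sup>2) (at z)"
proof -
  assume "z \<noteq> w"
  then have "(herglotz w has_field_derivative (\<i> * (z - w) - \<i> * (z + w)) / ((z - w) * (z - w))) (at z)"
    unfolding herglotz_def [abs_def] by (auto intro!: derivative_eq_intros)
  moreover have "\<i> * (z - w) - \<i> * (z + w) = - 2 * \<i> * w" by algebra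
  ultimately show ?thesis by (simp only: power2_eq_square)
qed

lemma Re_const_sign:
  assumes "continuous_on (ball 0 1) f" "\<And>z. z \<in> ball 0 1 \<Longrightarrow> Re (f z) \<noteq> 0" "0 < Re (f 0)" "cmod z < 1"
  shows "0 < Re (f z)"
proof (rule ccontr)
  assume "\<not> 0 < Re (f z)"
  have conn: "connected ((\<lambda>z. Re (f z)) ` ball (0::complex) 1)"
    by (intro connected_continuous_image continuous_intros assms(1)) auto
  have "0 \<in> (\<lambda>z. Re (f z)) ` ball (0::complex) 1"
    by (rule connectedD_interval[OF conn, of "Re (f z)" "Re (f 0)"])
      (use assms(3,4) \<open>\<not> 0 < Re (f z)\<close> in auto)
  then show False using assms(2) by auto
qed

lemma continuous_le_on_cball:
  fixes f :: "complex \<Rightarrow> real"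
  assumes "continuous_on (cball 0 1) f" "\<And>z. cmod z < 1 \<Longrightarrow> 0 \<le> f z" "cmod z \<le> 1"
  shows "0 \<le> f z"
proof -
  have "continuous_on (closure (ball (0::complex) 1)) f"
    using assms(1) by (simp add: closure_ball)
  then show ?thesis
    using continuous_ge_on_closure[of "ball 0 1" f z 0] assms by (simp add: closure_ball)
qed

context arc_system
begin

text \<open>Numerator and denominator of \<open>R\<close> are kept apart because \<open>R\<close>
  has poles on the circle, whereas the square roots of both polynomials are continuous
  there.\<close>

definition "Apoly = smult (cis (L / 2)) (\<Prod>j\<in>J. [:- cis (a j), 1:])"
definition "Bpoly = (\<Prod>j\<in>J. [:- cis (b j), 1:])"

lemma poly_Apoly: "poly Apoly z = cis (L / 2) * (\<Prod>j\<in>J. z - cis (a j))"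
  by (simp add: Apoly_def poly_prod)

lemma poly_Bpoly: "poly Bpoly z = (\<Prod>j\<in>J. z - cis (b j))"
  by (simp add: Bpoly_def poly_prod)

lemma R_poly: "R z = poly Apoly z / poly Bpoly z"
  by (simp add: R_def poly_Apoly poly_Bpoly prod_dividef)

lemma Bpoly_0_iff: "poly Bpoly z = 0 \<longleftrightarrow> z \<in> (\<lambda>j. cis (b j)) ` J"
  using fin by (auto simp: poly_Bpoly)

lemma Apoly_0_iff: "poly Apoly z = 0 \<longleftrightarrow> z \<in> (\<lambda>j. cis (a j)) ` J"
  using fin by (auto simp: poly_Apoly)

lemma Apoly_Bpoly_coprime: "poly Apoly z \<noteq> 0 \<or> poly Bpoly z \<noteq> 0"
  using cis_a_neq_b by (auto simp: Apoly_0_iff Bpoly_0_iff)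

lemma Bpoly_disc: "cmod z < 1 \<Longrightarrow> poly Bpoly z \<noteq> 0"
  by (auto simp: Bpoly_0_iff)

lemma Apoly_disc: "cmod z < 1 \<Longrightarrow> poly Apoly z \<noteq> 0"
  by (auto simp: Apoly_0_iff)

text \<open>First and second moments of the real kernel values: on the circle away from the poles,
  \<open>D\<close> is \<open>R\<close> minus its constant term, and \<open>V\<close> governs the
  derivative of \<open>R\<close>.\<close>

definition "D z = (\<Sum>k\<in>J. wt k * Re (herglotz (cis (b k)) z))"
definition "V z = (\<Sum>k\<in>J. wt k * (Re (herglotz (cis (b k)) z))\<^sup>2)"

lemma herglotz_circle:
  "cmod z = 1 \<Longrightarrow> herglotz (cis x) z = of_real (Re (herglotz (cis x) z))"
  using Im_herglotz[of "cis x" z] by (simp add: complex_eq_iff)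

lemma R_circle_D:
  assumes "cmod z = 1" "z \<notin> (\<lambda>j. cis (b j)) ` J"
  shows "R z = of_real (cos (L / 2) + D z)"
proof -
  have "(\<Sum>k\<in>J. of_real (wt k) * herglotz (cis (b k)) z) = of_real (D z)"
    unfolding D_def of_real_sum of_real_mult herglotz_circle[OF assms(1), symmetric] ..
  then show ?thesis unfolding R_eq[OF assms(2)] by simp
qed

text \<open>Term by term, z times the derivative of a kernel is i / 2 times one plus its square, as
  for the cotangent. The ones add up to the sum of the weights, sin (L / 2).\<close>

lemma R_DERIV:
  assumes "cmod z = 1" "z \<notin> (\<lambda>j. cis (b j)) ` J"
  shows "\<exists>d. (R has_field_derivative d) (at z) \<and> z * d = \<i> / 2 * of_real (sin (L / 2) + V z)"
proof (intro exI conjI)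
  let ?d = "\<Sum>k\<in>J. of_real (wt k) * (- 2 * \<i> * cis (b k) / (z - cis (b k))\<^sup>2)"
  let ?F = "\<lambda>z. of_real (cos (L / 2)) + (\<Sum>k\<in>J. of_real (wt k) * herglotz (cis (b k)) z)"
  have F: "(?F has_field_derivative 0 + ?d) (at z)"
    using assms(2) by (intro DERIV_add DERIV_const DERIV_sum DERIV_cmult herglotz_DERIV) auto
  have "open (- (\<lambda>j. cis (b j)) ` J)"
    using fin by (intro open_Compl finite_imp_closed) auto
  from has_field_derivative_transform_within_open[OF F this]
  show "(R has_field_derivative ?d) (at z)"
    using assms(2) R_eq by simp
  have "z * (of_real (wt k) * (- 2 * \<i> * cis (b k) / (z - cis (b k))\<^sup>2)) =
      \<i> / 2 * of_real (wt k + wt k * (Re (herglotz (cis (b k)) z))\<^sup>2)" if "k \<in> J" for k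
  proof -
    have "z \<noteq> cis (b k)" using assms(2) that by auto
    then have "- 4 * z * cis (b k) / (z - cis (b k))\<^sup>2 = of_real (1 + (Re (herglotz (cis (b k)) z))\<^sup>2)"
      using one_plus_herglotz_sq[of z "cis (b k)"] herglotz_circle[OF assms(1), of "b k"]
      by (metis of_real_1 of_real_add of_real_power)
    then have "\<i> / 2 * of_real (wt k) * (- 4 * z * cis (b k) / (z - cis (b k))\<^sup>2) =
        \<i> / 2 * of_real (wt k) * of_real (1 + (Re (herglotz (cis (b k)) z))\<^sup>2)"
      by simp
    then show ?thesis by (simp add: algebra_simps)
  qed
  then have "z * ?d = (\<Sum>k\<in>J. \<i> / 2 * of_real (wt k + wt k * (Re (herglotz (cis (b k)) z))\<^sup>2))"
    unfolding sum_distrib_left by (intro sum.cong) auto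
  also have "\<dots> = \<i> / 2 * of_real (sin (L / 2) + V z)"
    unfolding V_def sum_wt[symmetric] sum.distrib[symmetric] of_real_sum sum_distrib_left ..
  finally show "z * ?d = \<i> / 2 * of_real (sin (L / 2) + V z)" .
qed

text \<open>Kernels with different poles take different values at the same point, so the moments of
  two or more arcs satisfy Cauchy-Schwarz strictly. For one arc the two sides would agree.\<close>

lemma D_V_strict:
  assumes "2 \<le> card J" "cmod z = 1" "z \<notin> (\<lambda>j. cis (b j)) ` J"
  shows "(D z)\<^sup>2 < sin (L / 2) * V z"
proof -
  obtain i j where ij: "i \<in> J" "j \<in> J" "i \<noteq> j"
    using assms(1) card_le_Suc0_iff_eq[OF fin] by fastforce
  have "cis (b i) \<noteq> cis (b j)" using inj_b ij by (auto simp: inj_on_def)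
  then have "herglotz (cis (b i)) z \<noteq> herglotz (cis (b j)) z"
    using herglotz_inj[of "cis (b i)" z "cis (b j)"] assms(2,3) ij by fastforce
  then have "Re (herglotz (cis (b i)) z) \<noteq> Re (herglotz (cis (b j)) z)"
    using herglotz_circle[OF assms(2)] by metis
  from weighted_cauchy_schwarz_strict[where w = wt, OF fin wt_pos ij(1,2) this] show ?thesis
    by (simp add: D_def V_def sum_wt)
qed

text \<open>Here \<open>f\<close> stands for \<zeta> at z and \<open>zd\<close> for z times its
  derivative, so the expression is z X' / X for X = (\<zeta> + cnj c) / (\<zeta> + c). The squared
  modulus \<open>N\<close> of the denominator equals \<open>D\<close>^2 + sin^2 (L / 2), because
  \<open>D\<close> = -\<rho>^2 - cos (L / 2). The bound -1/2 is then exactly the strict moment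
  inequality.\<close>

lemma Re_log_derivative_bound:
  assumes "2 \<le> card J" "cmod z = 1" "z \<notin> (\<lambda>j. cis (b j)) ` J" "R z = - of_real (\<rho>\<^sup>2)" "0 < \<rho>"
    and zd: "2 * (- \<i> * of_real \<rho>) * zd = \<i> / 2 * of_real (sin (L / 2) + V z)"
    and c: "c = cis (- L / 4)" and f: "f = - \<i> * of_real \<rho>"
  shows "Re (zd * (c - cnj c) / ((f + c) * (f + cnj c))) < - 1 / 2"
proof -
  define \<gamma> W where "\<gamma> = L / 4" and "W = (sin (L / 2) + V z) / 2"
  define s N where "s = sin \<gamma>" and "N = (1 - \<rho>\<^sup>2)\<^sup>2 + (2 * \<rho> * cos \<gamma>)\<^sup>2"
  have L2: "L / 2 = 2 * \<gamma>" by (simp add: \<gamma>_def)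
  have cc: "c - cnj c = - 2 * \<i> * of_real s" "(f + c) * (f + cnj c) = Complex (1 - \<rho>\<^sup>2) (- 2 * \<rho> * cos \<gamma>)"
    unfolding c f \<gamma>_def s_def using sin_cos_squared_add[of "L / 4"]
    by (auto simp: complex_eq_iff power2_eq_square algebra_simps)
  have "2 * (- \<i> * of_real \<rho>) * zd = \<i> * of_real W"
    using zd by (simp add: W_def)
  then have "of_real \<rho> * zd = - of_real (W / 2)"
    by (auto simp: complex_eq_iff)
  then have "zd = of_real (- W / (2 * \<rho>))"
    using assms(5) by (auto simp: complex_eq_iff field_simps)
  then have num: "zd * (c - cnj c) = \<i> * of_real (W * s / \<rho>)"
    unfolding cc(1) by simp
  have "Re (zd * (c - cnj c) / ((f + c) * (f + cnj c))) = W * s / \<rho> * (- 2 * \<rho> * cos \<gamma>) / N"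
    unfolding num cc(2) N_def by (simp only: Re_divide complex.sel) (simp add: power2_eq_square)
  also have "\<dots> = - (2 * s * cos \<gamma>) * W / N" using assms(5) by simp
  also have "2 * s * cos \<gamma> = sin (L / 2)"
    unfolding L2 sin_double s_def by simp
  finally have eq: "Re (zd * (c - cnj c) / ((f + c) * (f + cnj c))) = - (sin (L / 2) * W / N)" by simp
  have "cos (L / 2) + D z = - \<rho>\<^sup>2"
    using assms(4) R_circle_D[OF assms(2,3)] by (metis of_real_eq_iff of_real_minus)
  then have Dz: "D z = - \<rho>\<^sup>2 - cos (L / 2)" by simp
  have sq: "(sin (L / 2))\<^sup>2 + (cos (L / 2))\<^sup>2 = 1" by simp
  have cos2: "cos (L / 2) = 2 * (cos \<gamma>)\<^sup>2 - 1"
    unfolding L2 by (rule cos_double_cos)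
  have "N = 1 + (\<rho>\<^sup>2)\<^sup>2 + 2 * \<rho>\<^sup>2 * cos (L / 2)"
    unfolding N_def cos2 by (simp add: power2_eq_square algebra_simps)
  also have "\<dots> = (D z)\<^sup>2 + (sin (L / 2))\<^sup>2"
    unfolding Dz using sq by (simp add: power2_eq_square algebra_simps)
  finally have N: "N = (D z)\<^sup>2 + (sin (L / 2))\<^sup>2" .
  then have Npos: "0 < N" using sin_L_pos by (simp add: add_nonneg_pos)
  have "N < 2 * (sin (L / 2) * W)"
    unfolding N W_def using D_V_strict[OF assms(1,2,3)] by (simp add: power2_eq_square algebra_simps)
  then have "1 / 2 < sin (L / 2) * W / N" using Npos by (simp add: field_simps)
  then show ?thesis unfolding eq by simp
qed

end

section \<open>The comparison function\<close>

lemma cmod_add_mult_sq: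
  "(cmod (x + c * y))\<^sup>2 = (cmod x)\<^sup>2 + (cmod c * cmod y)\<^sup>2 + 2 * Re (x * cnj y * cnj c)"
  unfolding norm_mult[symmetric] cmod_power2 by (simp add: power2_eq_square algebra_simps)

text \<open>The real part of Q (r z) / Q z replaces the modulus: it equals 1 at r = 1, is at most 1
  for smaller r, and its derivative at r = 1 is the quantity in question.\<close>

lemma radial_derivative_nonneg:
  assumes "(Q has_field_derivative d) (at z)" "Q z \<noteq> 0"
    and max: "\<And>r. 0 < r \<Longrightarrow> r < 1 \<Longrightarrow> cmod (Q (of_real r * z)) \<le> cmod (Q z)"
  shows "0 \<le> Re (z * d / Q z)"
proof (rule ccontr)
  assume neg: "\<not> 0 \<le> Re (z * d / Q z)"
  define \<phi> where "\<phi> r = Re (Q (of_real r * z) / Q z)" for r :: real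
  have 1: "((\<lambda>r. of_real r * z) has_vector_derivative z) (at 1)"
    by (auto intro!: derivative_eq_intros simp: has_vector_derivative_def scaleR_conv_of_real)
  have "((Q \<circ> (\<lambda>r. of_real r * z)) has_vector_derivative z * d) (at (1::real))"
    using field_vector_diff_chain_at[OF 1, of Q d] assms(1) by simp
  then have "((\<lambda>r. Q (of_real r * z) / Q z) has_vector_derivative z * d / Q z) (at (1::real))"
    by (simp add: o_def has_vector_derivative_divide)
  then have "(\<phi> has_vector_derivative Re (z * d / Q z)) (at 1)"
    unfolding \<phi>_def by (rule bounded_linear.has_vector_derivative[OF bounded_linear_Re])
  then have "DERIV \<phi> 1 :> Re (z * d / Q z)"
    by (simp add: has_real_derivative_iff_has_vector_derivative)
  from DERIV_neg_dec_left[OF this] neg obtain e where e: "0 < e" "\<And>x. 0 < x \<Longrightarrow> x < e \<Longrightarrow> \<phi> 1 < \<phi> (1 - x)"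
    by auto
  define x where "x = min (e / 2) (1 / 2)"
  have x: "0 < x" "x < e" "x < 1" using e(1) by (auto simp: x_def min_def)
  have "\<phi> (1 - x) \<le> cmod (Q (of_real (1 - x) * z) / Q z)"
    unfolding \<phi>_def by (rule complex_Re_le_cmod)
  also have "\<dots> \<le> 1" using max[of "1 - x"] x assms(2) by (simp add: norm_divide)
  finally show False using e(2)[of x] x assms(2) by (simp add: \<phi>_def)
qed

context arc_system
begin

text \<open>If \<zeta> = sqrt R with \<zeta> 0 = cis (- L / 4), then \<zeta> maps the disc into the fourth quadrant, and
  X = (\<zeta> + cnj (\<zeta> 0)) / (\<zeta> + \<zeta> 0) below. On a single arc X is the m-th root of the corresponding
  quantity for the extremal polynomial; for several arcs it serves as a comparison function.\<close>

lemma comparison_function: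
  assumes card: "2 \<le> card J"
  obtains X where "continuous_on (cball 0 1) X" "X holomorphic_on ball 0 1"
    "\<And>z. cmod z \<le> 1 \<Longrightarrow> cmod (X z) \<le> 1" "cmod (X 0) = cos (L / 4)"
    "\<And>k t. k \<in> J \<Longrightarrow> a k < t \<Longrightarrow> t < b k \<Longrightarrow> X (cis t) \<noteq> 0 \<and>
       (\<exists>d. (X has_field_derivative d) (at (cis t)) \<and> Re (cis t * d / X (cis t)) < - 1 / 2)"
proof -
  define c where "c = cis (- L / 4)"
  have cpos: "0 < Re c" "Im c < 0"
    using L_pos L_less sin_gt_zero[of "L / 4"] by (auto simp: c_def intro!: cos_gt_zero)
  have nc: "cmod c = 1" by (simp add: c_def)
  obtain be where be: "disc_sqrt Bpoly be" using disc_sqrt_exists Bpoly_disc by blast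
  \<comment> \<open>The sign of the root of \<open>Apoly\<close> is prescribed at the origin so that
    the quotient \<open>f\<close> starts at \<open>c\<close>, inside the fourth quadrant.\<close>
  have "(c * be 0)\<^sup>2 = c\<^sup>2 * poly Bpoly 0"
    using be by (simp add: power_mult_distrib disc_sqrt_def)
  also have "c\<^sup>2 = R 0" unfolding R_0 c_def by (simp add: cis_mult power2_eq_square)
  also have "R 0 * poly Bpoly 0 = poly Apoly 0" using Bpoly_disc[of 0] by (simp add: R_poly)
  finally obtain al where al: "disc_sqrt Apoly al" "al 0 = c * be 0"
    using disc_sqrt_exists_value Apoly_disc by blast
  have sq: "(al z)\<^sup>2 = poly Apoly z" "(be z)\<^sup>2 = poly Bpoly z" for z
    using al be by (auto simp: disc_sqrt_def)
  have cont: "continuous_on (cball 0 1) al" "continuous_on (cball 0 1) be"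
    using al be by (auto simp: disc_sqrt_def)
  have be0: "be z \<noteq> 0" if "cmod z < 1" for z using Bpoly_disc[OF that] sq(2)[of z] by auto
  define f where "f z = al z / be z" for z
  have fsq: "(f z)\<^sup>2 = R z" for z by (simp add: f_def power_divide sq R_poly)
  have Imsq: "Im ((f z)\<^sup>2) = 2 * Re (f z) * Im (f z)" for z by (simp add: power2_eq_square)
  have Ref: "0 < Re (f z)" if "cmod z < 1" for z
  proof (rule Re_const_sign[OF _ _ _ that])
    show "continuous_on (ball 0 1) f"
      unfolding f_def by (intro continuous_intros continuous_on_subset[OF cont(1)] continuous_on_subset[OF cont(2)])
        (auto simp: be0)
    show "Re (f z) \<noteq> 0" if "z \<in> ball 0 1" for z
      using Im_R_neg[of z] that Imsq[of z] fsq[of z] by auto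
    show "0 < Re (f 0)" using cpos be0[of 0] by (simp add: f_def al(2))
  qed
  have Imf: "Im (f z) < 0" if "cmod z < 1" for z
    using Im_R_neg[OF that] Ref[OF that] Imsq[of z] fsq[of z] by (auto simp: mult_less_0_iff)
  \<comment> \<open>The product with the conjugate has the same argument as \<open>f\<close> but no
    poles, so the quadrant condition passes to the whole circle by continuity.\<close>
  define w where "w z = al z * cnj (be z)" for z
  have wf: "w z = f z * of_real ((cmod (be z))\<^sup>2)" if "be z \<noteq> 0" for z
    unfolding complex_norm_square using that by (simp add: w_def f_def)
  have Rew: "0 \<le> Re (w z)" if "cmod z \<le> 1" for z
  proof (rule continuous_le_on_cball[OF _ _ that])
    show "continuous_on (cball 0 1) (\<lambda>z. Re (w z))" unfolding w_def by (intro continuous_intros cont)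
    show "0 \<le> Re (w z)" if "cmod z < 1" for z
      using Ref[OF that] wf[OF be0[OF that]] by simp
  qed
  have Imw: "Im (w z) \<le> 0" if "cmod z \<le> 1" for z
  proof -
    have "0 \<le> - Im (w z)"
    proof (rule continuous_le_on_cball[OF _ _ that])
      show "continuous_on (cball 0 1) (\<lambda>z. - Im (w z))" unfolding w_def by (intro continuous_intros cont)
      show "0 \<le> - Im (w z)" if "cmod z < 1" for z
        using Imf[OF that] wf[OF be0[OF that]] by (simp add: mult_nonpos_nonneg)
    qed
    then show ?thesis by simp
  qed
  define X where "X z = (al z + cnj c * be z) / (al z + c * be z)" for z
  have pos: "0 < (cmod (al z))\<^sup>2 + (cmod (be z))\<^sup>2" for z
  proof -
    have "al z \<noteq> 0 \<or> be z \<noteq> 0" using Apoly_Bpoly_coprime[of z] sq[of z] by auto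
    then show ?thesis by (auto simp: add_pos_nonneg add_nonneg_pos)
  qed
  \<comment> \<open>The two squared moduli differ only in the sign of the term Im w * Im c, which is
    nonnegative in the closed fourth quadrant.\<close>
  have den: "0 < (cmod (al z + c * be z))\<^sup>2" and
    num: "(cmod (al z + cnj c * be z))\<^sup>2 \<le> (cmod (al z + c * be z))\<^sup>2" if "cmod z \<le> 1" for z
  proof -
    have *: "0 \<le> Re (w z) * Re c" "0 \<le> Im (w z) * Im c"
      using Rew[OF that] Imw[OF that] cpos by (auto simp: mult_nonpos_nonpos)
    have 1: "(cmod (al z + c * be z))\<^sup>2 = (cmod (al z))\<^sup>2 + (cmod (be z))\<^sup>2 + 2 * (Re (w z) * Re c + Im (w z) * Im c)"
      unfolding cmod_add_mult_sq w_def[symmetric] by (simp add: nc)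
    have 2: "(cmod (al z + cnj c * be z))\<^sup>2 = (cmod (al z))\<^sup>2 + (cmod (be z))\<^sup>2 + 2 * (Re (w z) * Re c - Im (w z) * Im c)"
      unfolding cmod_add_mult_sq w_def[symmetric] by (simp add: nc)
    show "0 < (cmod (al z + c * be z))\<^sup>2" 
      unfolding 1 using * by (intro add_pos_nonneg[OF pos]) simp
    show "(cmod (al z + cnj c * be z))\<^sup>2 \<le> (cmod (al z + c * be z))\<^sup>2" 
      unfolding 1 2 using * by simp
  qed
  have den0: "al z + c * be z \<noteq> 0" if "cmod z \<le> 1" for z using den[OF that] by auto
  show thesis
  proof
    show "continuous_on (cball 0 1) X"
      unfolding X_def using den0 by (intro continuous_intros cont) auto
    show "X holomorphic_on ball 0 1"
      unfolding X_def using den0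
      by (intro holomorphic_intros disc_sqrt_holomorphic[OF al(1) Apoly_disc] disc_sqrt_holomorphic[OF be Bpoly_disc]) auto
    show "cmod (X z) \<le> 1" if "cmod z \<le> 1" for z
    proof -
      have "cmod (al z + cnj c * be z) \<le> cmod (al z + c * be z)"
        using num[OF that] by (rule power2_le_imp_le) simp
      then show ?thesis using den0[OF that] by (simp add: X_def norm_divide)
    qed
    have "X 0 = (be 0 * (c + cnj c)) / (be 0 * (c + c))"
      unfolding X_def al(2) by (simp add: algebra_simps)
    also have "\<dots> = (c + cnj c) / (c + c)" using be0[of 0] by simp
    finally have "cmod (X 0) = cmod (of_real (2 * Re c)) / cmod (2 * c)"
      by (simp add: norm_divide complex_add_cnj)
    then show "cmod (X 0) = cos (L / 4)"
      using cpos by (simp add: norm_mult nc) (simp add: c_def)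
    fix k t assume kt: "k \<in> J" "a k < t" "t < b k"
    define z where "z = cis t"
    have z1: "cmod z = 1" by (simp add: z_def)
    obtain x where x: "x < 0" "R z = of_real x" using R_neg[OF kt] z_def by auto
    then have AB: "poly Apoly z \<noteq> 0" "poly Bpoly z \<noteq> 0" by (auto simp: R_poly)
    then have np: "z \<notin> (\<lambda>j. cis (b j)) ` J" using Bpoly_0_iff by blast
    have bz: "be z \<noteq> 0" using AB sq(2)[of z] by auto
    define \<rho> where "\<rho> = sqrt (- x)"
    have \<rho>: "0 < \<rho>" "x = - \<rho>\<^sup>2" using x by (auto simp: \<rho>_def)
    have fz2: "(f z)\<^sup>2 = - of_real (\<rho>\<^sup>2)" using fsq[of z] x \<rho> by simp
    \<comment> \<open>On an arc \<open>R\<close> is negative, so \<open>f\<close> is imaginary; the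
      quadrant condition on the circle selects the root in the lower half-plane.\<close>
    have "(f z)\<^sup>2 = (- \<i> * of_real \<rho>)\<^sup>2" unfolding fz2 by (simp add: power_mult_distrib)
    then have "f z = - \<i> * of_real \<rho> \<or> f z = \<i> * of_real \<rho>" by (auto simp: power2_eq_iff)
    moreover have "Im (f z) \<le> 0"
      using Imw[of z] z1 wf[OF bz] bz by (auto simp: mult_le_0_iff)
    ultimately have fz: "f z = - \<i> * of_real \<rho>" using \<rho> by auto
    have nz: "f z + c \<noteq> 0" "f z + cnj c \<noteq> 0"
      using cpos unfolding fz by (auto simp: complex_eq_iff)
    obtain f' where f': "(f has_field_derivative f') (at z)"
    proof -
      have "f field_differentiable at z"
        unfolding f_def using al(1) be AB bz z1
        by (intro field_differentiable_divide) (auto simp: disc_sqrt_def)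
      then show ?thesis using that by (auto simp: field_differentiable_def)
    qed
    obtain d where d: "(R has_field_derivative d) (at z)" "z * d = \<i> / 2 * of_real (sin (L / 2) + V z)"
      using R_DERIV[OF z1 np] by blast
    have "((\<lambda>z. (f z)\<^sup>2) has_field_derivative 2 * f z * f') (at z)"
      by (auto intro!: derivative_eq_intros f')
    then have "2 * f z * f' = d" unfolding fsq using d(1) DERIV_unique by blast
    then have zd: "2 * (- \<i> * of_real \<rho>) * (z * f') = \<i> / 2 * of_real (sin (L / 2) + V z)"
      using d(2) fz by (metis mult.assoc mult.left_commute)
    have Xf: "X u = (f u + cnj c) / (f u + c)" if "be u \<noteq> 0" for u
    proof -
      have "al u + cnj c * be u = be u * (f u + cnj c)" "al u + c * be u = be u * (f u + c)"
        using that by (simp_all add: f_def distrib_left)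
      then show ?thesis using that by (simp add: X_def)
    qed
    have "isCont be z"
      using be AB z1 by (auto simp: disc_sqrt_def intro!: field_differentiable_imp_continuous_at)
    then have "\<forall>\<^sub>F u in nhds z. be u \<noteq> 0"
      using continuous_at_avoid[of z be 0] bz by (auto simp: eventually_nhds_metric dist_commute)
    then have ev: "\<forall>\<^sub>F u in nhds z. X u = (f u + cnj c) / (f u + c)"
      by eventually_elim (rule Xf)
    have "((\<lambda>u. (f u + cnj c) / (f u + c)) has_field_derivative (f' * (f z + c) - (f z + cnj c) * f') / ((f z + c) * (f z + c))) (at z)"
      using nz by (auto intro!: derivative_eq_intros f')
    then have X': "(X has_field_derivative (f' * (f z + c) - (f z + cnj c) * f') / ((f z + c) * (f z + c))) (at z)"
      using DERIV_cong_ev[OF refl ev refl] by blast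
    have "z * ((f' * (f z + c) - (f z + cnj c) * f') / ((f z + c) * (f z + c))) / X z =
       (z * f') * (c - cnj c) / ((f z + c) * (f z + cnj c))"
      unfolding Xf[OF bz] using nz by (simp add: divide_simps) (simp add: algebra_simps)
    also have "Re \<dots> < - 1 / 2"
      by (rule Re_log_derivative_bound[OF card z1 np _ \<rho>(1) zd c_def fz]) (simp add: x \<rho>)
    finally have "Re (z * ((f' * (f z + c) - (f z + cnj c) * f') / ((f z + c) * (f z + c))) / X z) < - 1 / 2" .
    moreover have "X z \<noteq> 0" unfolding Xf[OF bz] using nz by simp
    ultimately show "X (cis t) \<noteq> 0 \<and>
       (\<exists>d. (X has_field_derivative d) (at (cis t)) \<and> Re (cis t * d / X (cis t)) < - 1 / 2)"
      using X' unfolding z_def by blast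
  qed
qed

end

section \<open>Several arcs are not optimal\<close>

text \<open>By the parallelogram law the moduli of u + v and u - v have product r^2 and sum of
  squares 2 r^2, which forces them to be equal.\<close>

lemma parallelogram_eq_half:
  fixes u v :: complex
  assumes "cmod (u + v) * cmod (u - v) = r\<^sup>2" "(cmod u)\<^sup>2 + (cmod v)\<^sup>2 = r\<^sup>2" "0 \<le> r"
  shows "cmod (u + v) = r"
proof -
  have "(cmod (u + v))\<^sup>2 + (cmod (u - v))\<^sup>2 = 2 * ((cmod u)\<^sup>2 + (cmod v)\<^sup>2)"
    unfolding cmod_power2 by (simp add: power2_eq_square algebra_simps)
  then have "(cmod (u + v) - cmod (u - v))\<^sup>2 = 0"
    using assms(1,2) by (simp add: power2_diff)
  then have "(cmod (u + v))\<^sup>2 = r\<^sup>2" using assms(1) by (simp add: power2_eq_square)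
  then show ?thesis using assms(3) by simp
qed

lemma Im_eq_0_of_square_pos:
  assumes "(g::complex)\<^sup>2 = of_real x" "0 < x"
  shows "Im g = 0"
proof -
  have "Re g * Im g = 0" "Re g * Re g - Im g * Im g = x"
    using assms(1) by (auto simp: complex_eq_iff power2_eq_square)
  then show ?thesis using assms(2) by (metis mult_eq_0_iff diff_0 less_le_not_le mult_zero_left neg_le_0_iff_le zero_le_square)
qed

text \<open>With M z = (p z)^2 - h^2 z^m, the function Z = p + sqrt M satisfies Z (p - sqrt M) = h^2 z^m.
  Hence |Z| = h where |p| \<le> h on the circle, while the radial derivative of ln |Z| equals m/2 where |p| > h.\<close>

lemma (in arc_system) several_arcs_bound:
  fixes p :: "complex poly" and m :: nat and h :: real
  assumes card: "2 \<le> card J" and m: "1 \<le> m" and h: "0 < h"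
    and p_circle: "\<And>z. cmod z = 1 \<Longrightarrow> (poly p z)\<^sup>2 = z ^ m * of_real ((cmod (poly p z))\<^sup>2)"
    and p_deriv: "\<And>z. cmod z = 1 \<Longrightarrow> poly p z \<noteq> 0 \<Longrightarrow> Re (z * poly (pderiv p) z / poly p z) = m / 2"
    and p0: "cmod (poly p 0) = 1"
    and p_disc: "\<And>z. cmod z < 1 \<Longrightarrow> (poly p z)\<^sup>2 \<noteq> of_real (h\<^sup>2) * z ^ m"
    and p_arc: "\<And>k t. k \<in> J \<Longrightarrow> a k < t \<Longrightarrow> t < b k \<Longrightarrow> h < cmod (poly p (cis t))"
    and p_super: "\<And>z. cmod z = 1 \<Longrightarrow> h < cmod (poly p z) \<Longrightarrow> \<exists>k\<in>J. \<exists>t. a k < t \<and> t < b k \<and> z = cis t"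
  shows "2 * cos (L / 4) ^ m < h"
proof -
  obtain X where X: "continuous_on (cball 0 1) X" "X holomorphic_on ball 0 1"
    "\<And>z. cmod z \<le> 1 \<Longrightarrow> cmod (X z) \<le> 1" "cmod (X 0) = cos (L / 4)"
    "\<And>k t. k \<in> J \<Longrightarrow> a k < t \<Longrightarrow> t < b k \<Longrightarrow> X (cis t) \<noteq> 0 \<and>
       (\<exists>d. (X has_field_derivative d) (at (cis t)) \<and> Re (cis t * d / X (cis t)) < - 1 / 2)"
    using comparison_function[OF card] by metis
  define M where "M = p ^ 2 - monom (of_real (h\<^sup>2)) m"
  have M: "poly M z = (poly p z)\<^sup>2 - of_real (h\<^sup>2) * z ^ m" for z
    by (simp add: M_def poly_monom)
  have M0: "poly M z \<noteq> 0" if "cmod z < 1" for z using p_disc[OF that] by (simp add: M)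
  \<comment> \<open>With this sign \<open>Z 0\<close> = 2 p(0); the opposite sign would make
    \<open>Z\<close> vanish at the origin.\<close>
  obtain s where s: "disc_sqrt M s" "s 0 = poly p 0"
    using disc_sqrt_exists_value[of M "poly p 0"] M0 m by (auto simp: M power_0_left)
  have ssq: "(s z)\<^sup>2 = poly M z" for z using s by (simp add: disc_sqrt_def)
  define Z where "Z z = poly p z + s z" for z
  define Q where "Q z = X z ^ m * Z z" for z
  have ZZ: "Z z * (poly p z - s z) = of_real (h\<^sup>2) * z ^ m" for z
    using ssq[of z] unfolding M by (simp add: Z_def algebra_simps power2_eq_square)
  have contQ: "continuous_on (cball 0 1) Q"
    unfolding Q_def Z_def using s(1) by (intro continuous_intros X(1)) (auto simp: disc_sqrt_def)
  have holQ: "Q holomorphic_on ball 0 1"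
    unfolding Q_def Z_def
    by (intro holomorphic_intros X(2) disc_sqrt_holomorphic[OF s(1) M0]) auto
  have Q0: "cmod (Q 0) = 2 * cos (L / 4) ^ m"
    using p0 X(4) by (simp add: Q_def Z_def s(2) norm_mult norm_power mult_2[symmetric])
  have Z_circle: "cmod (Z z) = h" if z: "cmod z = 1" "cmod (poly p z) \<le> h" for z
    unfolding Z_def
  proof (rule parallelogram_eq_half)
    show "cmod (poly p z + s z) * cmod (poly p z - s z) = h\<^sup>2"
      using arg_cong[OF ZZ[of z], of cmod] z h by (simp add: Z_def norm_mult norm_power)
    have "(s z)\<^sup>2 = z ^ m * of_real ((cmod (poly p z))\<^sup>2 - h\<^sup>2)"
      unfolding ssq M p_circle[OF z(1)] by (simp add: algebra_simps)
    then have "(cmod (s z))\<^sup>2 = \<bar>(cmod (poly p z))\<^sup>2 - h\<^sup>2\<bar>"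
      using z(1) by (metis norm_mult norm_of_real norm_power power_one mult_1)
    moreover have "(cmod (poly p z))\<^sup>2 \<le> h\<^sup>2" using z(2) by (rule power_mono) simp
    ultimately show "(cmod (poly p z))\<^sup>2 + (cmod (s z))\<^sup>2 = h\<^sup>2" by simp
  qed (use h in simp)
  have Q_arc: "\<exists>d. (Q has_field_derivative d) (at z) \<and> Q z \<noteq> 0 \<and> Re (z * d / Q z) < 0"
    if kt: "k \<in> J" "a k < t" "t < b k" "z = cis t" for k t z
  proof -
    have z1: "cmod z = 1" using kt by simp
    have hp: "h < cmod (poly p z)" using p_arc kt by simp
    then have p0: "poly p z \<noteq> 0" using h by auto
    define P where "P = (cmod (poly p z))\<^sup>2 - h\<^sup>2"
    have P: "0 < P" unfolding P_def using hp h by (simp add: power_strict_mono)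
    have s2: "(s z)\<^sup>2 = z ^ m * of_real P"
      unfolding ssq M p_circle[OF z1] P_def by (simp add: algebra_simps)
    have z0: "z \<noteq> 0" using z1 by auto
    have s0: "s z \<noteq> 0" using s2 P z0 by auto
    have Mz: "poly M z \<noteq> 0" using s0 ssq[of z] by auto
    obtain x where x: "(X has_field_derivative x) (at z)" "X z \<noteq> 0" "Re (z * x / X z) < - 1 / 2"
      using X(5)[OF kt(1-3)] kt(4) by auto
    define s' where "s' = poly (pderiv M) z / (2 * s z)"
    have s': "(s has_field_derivative s') (at z)"
      unfolding s'_def using z1 by (intro disc_sqrt_has_field_derivative[OF s(1) _ Mz]) simp
    define Z' where "Z' = poly (pderiv p) z + s'"
    have Z': "(Z has_field_derivative Z') (at z)"
      unfolding Z_def [abs_def] Z'_def by (intro DERIV_add poly_DERIV s')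
    have Z0: "Z z \<noteq> 0" using ZZ[of z] h z0 by auto
    have pM: "z * poly (pderiv M) z = 2 * poly p z * (z * poly (pderiv p) z) - of_nat m * (of_real (h\<^sup>2) * z ^ m)"
    proof -
      have pd: "pderiv M = 2 * p * pderiv p - monom (of_nat m * of_real (h\<^sup>2)) (m - 1)"
        by (simp add: M_def pderiv_diff pderiv_monom pderiv_mult power2_eq_square algebra_simps)
      have zm: "z ^ m = z * z ^ (m - 1)" using m by (cases m) auto
      show ?thesis unfolding pd zm by (simp add: poly_monom algebra_simps)
    qed
    define u where "u = z * poly (pderiv p) z"
    have "s z * (z * Z') = s z * u + poly p z * u - of_nat m / 2 * (of_real (h\<^sup>2) * z ^ m)"
    proof -
      have "s z * (z * Z') = s z * u + z * poly (pderiv M) z / 2"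
        unfolding Z'_def s'_def u_def using s0 by (simp add: distrib_left mult_ac)
      then show ?thesis unfolding pM u_def[symmetric] by (simp add: diff_divide_distrib)
    qed
    also have "\<dots> = Z z * (u - of_nat m / 2 * (poly p z - s z))"
    proof -
      have "y * u + x * u - n * ((x + y) * (x - y)) = (x + y) * (u - n * (x - y))" for n x y :: complex
        by algebra
      then show ?thesis unfolding ZZ[symmetric] Z_def by blast
    qed
    finally have sZ: "s z * (z * Z') = Z z * (u - of_nat m / 2 * (poly p z - s z))" .
    have ZL: "z * Z' / Z z = poly p z / s z * (u / poly p z - of_nat m / 2) + of_nat m / 2"
    proof -
      have "(u - n * (x - y)) / y = x / y * (u / x - n) + n" if "x \<noteq> 0" "y \<noteq> 0" for n x y :: complex
        using that by (simp add: field_simps)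
      moreover have "z * Z' / Z z = (u - of_nat m / 2 * (poly p z - s z)) / s z"
        using s0 Z0 sZ by (simp add: frac_eq_eq mult.commute del: of_nat_mult)
      ultimately show ?thesis using s0 p0 by metis
    qed
    \<comment> \<open>The quotient p / s is real because its square is positive, and u / p - m / 2
      is purely imaginary. Their product contributes nothing to the real part, which leaves m /
      2.\<close>
    have "(poly p z / s z)\<^sup>2 = of_real ((cmod (poly p z))\<^sup>2 / P)"
      unfolding power_divide s2 p_circle[OF z1] using z0 by simp
    then have "Im (poly p z / s z) = 0"
      by (rule Im_eq_0_of_square_pos) (use P p0 in simp)
    moreover have "Re (u / poly p z - of_nat m / 2) = 0"
      using p_deriv[OF z1 p0] by (simp add: u_def)
    ultimately have ReZ: "Re (z * Z' / Z z) = m / 2"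
      unfolding ZL plus_complex.sel times_complex.sel by simp
    define d where "d = of_nat m * x * X z ^ (m - 1) * Z z + X z ^ m * Z'"
    have d: "(Q has_field_derivative d) (at z)"
      unfolding Q_def [abs_def] d_def
      by (rule derivative_eq_intros x(1) Z' refl)+ (simp add: mult_ac)
    have Qz: "Q z \<noteq> 0" using x(2) Z0 by (simp add: Q_def)
    have "X z ^ m = X z * X z ^ (m - 1)" using m by (cases m) auto
    then have "z * d / Q z = of_nat m * (z * x / X z) + z * Z' / Z z"
      unfolding d_def Q_def using x(2) Z0 by (simp add: field_simps)
    moreover have "Re (of_nat m * v) = m * Re v" for v by simp
    ultimately have "Re (z * d / Q z) = m * Re (z * x / X z) + m / 2"
      using ReZ by (metis plus_complex.sel(1))
    also have "\<dots> < 0"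
      using mult_strict_left_mono[OF x(3), of "real m"] m by simp
    finally show ?thesis using d Qz by blast
  qed
  have not_max: "\<exists>w. cmod w < 1 \<and> cmod (Q z) < cmod (Q w)"
    if kt: "k \<in> J" "a k < t" "t < b k" "z = cis t" for k t z
  proof (rule ccontr)
    assume "\<not> ?thesis"
    moreover have "cmod (of_real r * z) < 1" if "0 < r" "r < 1" for r
      using that kt(4) by (simp add: norm_mult)
    ultimately have le: "cmod (Q (of_real r * z)) \<le> cmod (Q z)" if "0 < r" "r < 1" for r
      using that by (meson not_le)
    obtain d where d: "(Q has_field_derivative d) (at z)" "Q z \<noteq> 0" "Re (z * d / Q z) < 0"
      using Q_arc[OF kt] by blast
    show False using radial_derivative_nonneg[OF d(1,2) le] d(3) by simp
  qed
  obtain z1 where z1: "cmod z1 = 1" "\<And>z. cmod z = 1 \<Longrightarrow> cmod (Q z) \<le> cmod (Q z1)"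
  proof -
    have "\<exists>z\<in>sphere 0 1. \<forall>y\<in>sphere 0 1. cmod (Q y) \<le> cmod (Q z)"
      by (intro continuous_attains_sup continuous_intros continuous_on_subset[OF contQ]) auto
    then show ?thesis using that by auto
  qed
  have max: "cmod (Q z) \<le> cmod (Q z1)" if "cmod z \<le> 1" for z
    by (rule maximum_modulus_frontier[of Q "cball 0 1"])
      (use that z1 holQ contQ in \<open>auto simp: frontier_cball interior_cball\<close>)
  \<comment> \<open>End points of the segments and isolated points, where \<open>s\<close> vanishes
    and \<open>Q\<close> may fail to be differentiable, count as points with |p| \<le> h and are
    covered by the bound for \<open>Z\<close>.\<close>
  have "cmod (poly p z1) \<le> h"
  proof (rule ccontr)
    assume "\<not> cmod (poly p z1) \<le> h"
    then obtain k t where "k \<in> J" "a k < t" "t < b k" "z1 = cis t"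
      using p_super[OF z1(1)] by auto
    from not_max[OF this] max show False by (meson less_imp_le not_le)
  qed
  then have "cmod (Q z1) \<le> h"
    using X(3)[of z1] Z_circle[OF z1(1)] z1(1) h
    by (simp add: Q_def norm_mult norm_power mult_left_le_one_le power_le_one)
  then have le: "cmod (Q z) \<le> h" if "cmod z \<le> 1" for z using max[OF that] by simp
  \<comment> \<open>Equality would make \<open>Q\<close> constant on the closed disc, but at the
    midpoint of an arc |Q| is exceeded somewhere inside the disc.\<close>
  have "cmod (Q 0) \<noteq> h"
  proof
    assume eq: "cmod (Q 0) = h"
    have "Q constant_on ball 0 1"
      by (rule maximum_modulus_principle[OF holQ, where U = "ball 0 1" and \<xi> = 0])
        (use le eq in auto)
    then obtain c where c: "\<And>z. cmod z < 1 \<Longrightarrow> Q z = c" by (auto simp: constant_on_def)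
    have "Q z = c" if "cmod z \<le> 1" for z
      using continuous_constant_on_closure[of "ball 0 1" Q c z] contQ c that by (simp add: closure_ball)
    moreover obtain k where k: "k \<in> J" using ne by auto
    ultimately show False
      using not_max[OF k, of "(a k + b k) / 2"] ab[OF k] by auto
  qed
  then show ?thesis using le[of 0] Q0 by simp
qed

section \<open>Polynomials with zeros on the circle\<close>

definition zpoly :: "nat \<Rightarrow> (nat \<Rightarrow> real) \<Rightarrow> complex poly" where
  "zpoly m \<phi> = (\<Prod>j<m. [:- cis (\<phi> j), 1:])"

definition zmod :: "nat \<Rightarrow> (nat \<Rightarrow> real) \<Rightarrow> real \<Rightarrow> real" where
  "zmod m \<phi> t = cmod (poly (zpoly m \<phi>) (cis t))"

lemma poly_zpoly: "poly (zpoly m \<phi>) z = (\<Prod>j<m. z - cis (\<phi> j))"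
  by (simp add: zpoly_def poly_prod)

lemma cmod_cis_diff: "cmod (cis x - cis y) = 2 * \<bar>sin ((x - y) / 2)\<bar>"
  by (simp add: cis_diff norm_mult)

lemma zmod_eq: "zmod m \<phi> t = (\<Prod>j<m. 2 * \<bar>sin ((t - \<phi> j) / 2)\<bar>)"
  by (simp add: zmod_def poly_zpoly prod_norm[symmetric] cmod_cis_diff)

lemma zmod_nonneg: "0 \<le> zmod m \<phi> t"
  by (simp add: zmod_def)

lemma continuous_zmod [continuous_intros]: "continuous_on A (zmod m \<phi>)"
  unfolding zmod_eq [abs_def] by (intro continuous_intros) auto

lemma cis_periodic_int: "cis (t + 2 * pi * of_int k) = cis t"
  by (simp add: complex_eq_iff sin_add cos_add cos_int_2pin sin_int_2pin)

lemma zmod_periodic: "zmod m \<phi> (t + 2 * pi * of_int k) = zmod m \<phi> t"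
  by (simp only: zmod_def cis_periodic_int)

lemma zmod_periodic1: "zmod m \<phi> (t + 2 * pi) = zmod m \<phi> t"
  using zmod_periodic[of m \<phi> t 1] by simp

lemma zmod_zero: "j < m \<Longrightarrow> zmod m \<phi> (\<phi> j) = 0"
  by (auto simp: zmod_eq intro!: bexI[of _ j])

text \<open>The quotient is 1/2 minus i/2 times a kernel that is real on the circle. Each zero thus
  contributes 1/2 to the radial logarithmic derivative.\<close>

lemma Re_div_diff_circle:
  assumes "cmod z = 1" "cmod e = 1" "z \<noteq> e"
  shows "Re (z / (z - e)) = 1 / 2"
proof -
  have "z - e \<noteq> 0" using assms by simp
  then have "z / (z - e) = 1 / 2 + (z + e) / (z - e) / 2"
    by (simp add: field_simps)
  also have "(z + e) / (z - e) = - \<i> * herglotz e z"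
    by (simp add: herglotz_def)
  finally show ?thesis using Im_herglotz[of e z] assms by simp
qed

lemma pderiv_zpoly:
  assumes "poly (zpoly m \<phi>) z \<noteq> 0"
  shows "poly (pderiv (zpoly m \<phi>)) z / poly (zpoly m \<phi>) z = (\<Sum>j<m. 1 / (z - cis (\<phi> j)))"
  using assms
proof (induction m)
  case 0
  show ?case by (simp add: zpoly_def)
next
  case (Suc m)
  have split: "zpoly (Suc m) \<phi> = zpoly m \<phi> * [:- cis (\<phi> m), 1:]" by (simp add: zpoly_def)
  have nz: "poly (zpoly m \<phi>) z \<noteq> 0" "z - cis (\<phi> m) \<noteq> 0"
    using Suc.prems unfolding split by auto
  have "poly (pderiv (zpoly (Suc m) \<phi>)) z / poly (zpoly (Suc m) \<phi>) z =
     (poly (zpoly m \<phi>) z + (z - cis (\<phi> m)) * poly (pderiv (zpoly m \<phi>)) z) / (poly (zpoly m \<phi>) z * (z - cis (\<phi> m)))"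
    unfolding split pderiv_mult by (simp add: pderiv_pCons algebra_simps)
  also have "\<dots> = 1 / (z - cis (\<phi> m)) + poly (pderiv (zpoly m \<phi>)) z / poly (zpoly m \<phi>) z"
  proof -
    have "(p + x * q) / (p * x) = 1 / x + q / p" if "p \<noteq> 0" "x \<noteq> 0" for p q x :: complex
      using that by (simp add: add_divide_distrib)
    then show ?thesis using nz by blast
  qed
  finally show ?case using Suc.IH[OF nz(1)] by simp
qed

text \<open>On the circle (z - e)^2 = - z e |z - e|^2 for a zero e. Multiplying by the conjugate of
  -e removes the phase, so \<open>k\<close> is a square root of the product of these
  conjugates.\<close>

lemma zpoly_normalized:
  obtains k where "cmod k = 1"
    "\<And>z. cmod z = 1 \<Longrightarrow> (poly (smult k (zpoly m \<phi>)) z)\<^sup>2 = z ^ m * of_real ((cmod (poly (smult k (zpoly m \<phi>)) z))\<^sup>2)"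
proof
  define \<kappa> where "\<kappa> = (\<Prod>j<m. - cnj (cis (\<phi> j)))"
  have n\<kappa>: "cmod \<kappa> = 1" unfolding \<kappa>_def prod_norm[symmetric] by simp
  show nk: "cmod (csqrt \<kappa>) = 1" by (simp add: n\<kappa>)
  fix z :: complex assume z: "cmod z = 1"
  have "(poly (smult (csqrt \<kappa>) (zpoly m \<phi>)) z)\<^sup>2 = \<kappa> * (\<Prod>j<m. (z - cis (\<phi> j))\<^sup>2)"
    by (simp add: power_mult_distrib poly_zpoly prod_power_distrib)
  also have "\<dots> = (\<Prod>j<m. z * of_real ((cmod (z - cis (\<phi> j)))\<^sup>2))"
    unfolding \<kappa>_def prod.distrib[symmetric]
  proof (rule prod.cong)
    fix j
    have "cnj (cis (\<phi> j)) * cis (\<phi> j) = 1"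
      by (simp add: complex_eq_iff power2_eq_square[symmetric])
    moreover have "- w * (- z * v * x) = (w * v) * (z * x)" for v w x by simp
    ultimately show "- cnj (cis (\<phi> j)) * (z - cis (\<phi> j))\<^sup>2 = z * of_real ((cmod (z - cis (\<phi> j)))\<^sup>2)"
      by (metis mult_kernel_circle[OF z norm_cis] mult_1)
  qed simp
  also have "\<dots> = z ^ m * of_real ((cmod (poly (smult (csqrt \<kappa>) (zpoly m \<phi>)) z))\<^sup>2)"
    by (simp add: prod.distrib norm_mult n\<kappa> poly_zpoly prod_norm[symmetric] prod_power_distrib)
  finally show "(poly (smult (csqrt \<kappa>) (zpoly m \<phi>)) z)\<^sup>2 =
      z ^ m * of_real ((cmod (poly (smult (csqrt \<kappa>) (zpoly m \<phi>)) z))\<^sup>2)" .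
qed

lemma zpoly_log_derivative:
  assumes "cmod z = 1" "poly (zpoly m \<phi>) z \<noteq> 0"
  shows "Re (z * poly (pderiv (zpoly m \<phi>)) z / poly (zpoly m \<phi>) z) = m / 2"
proof -
  have "z * poly (pderiv (zpoly m \<phi>)) z / poly (zpoly m \<phi>) z = (\<Sum>j<m. z / (z - cis (\<phi> j)))"
    using arg_cong[OF pderiv_zpoly[OF assms(2)], of "\<lambda>x. z * x"] by (simp add: sum_distrib_left)
  then have "Re (z * poly (pderiv (zpoly m \<phi>)) z / poly (zpoly m \<phi>) z) = (\<Sum>j<m. Re (z / (z - cis (\<phi> j))))"
    by simp
  also have "\<dots> = (\<Sum>j<m. 1 / 2)"
    using assms(2) by (intro sum.cong refl Re_div_diff_circle assms(1)) (auto simp: poly_zpoly)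
  finally show ?thesis by simp
qed

text \<open>The value \<open>\<phi> m\<close> repeats the first zero one turn later and is not a
  further factor, since \<open>zpoly m \<phi>\<close> uses only indices below m. Thus the m gaps
  between consecutive values cover the circle, and the \<open>c j\<close> witness that each gap
  reaches the level.\<close>

locale separated_zeros =
  fixes m :: nat and \<phi> c :: "nat \<Rightarrow> real" and h :: real
  assumes m: "1 \<le> m" and h: "0 < h"
    and wrap: "\<phi> m = \<phi> 0 + 2 * pi"
    and gap: "j < m \<Longrightarrow> \<phi> j < c j" "j < m \<Longrightarrow> c j < \<phi> (Suc j)"
    and peak: "j < m \<Longrightarrow> h \<le> zmod m \<phi> (c j)"
begin

lemma \<phi>_mono: "i \<le> j \<Longrightarrow> j \<le> m \<Longrightarrow> \<phi> i \<le> \<phi> j"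
proof (induction j rule: dec_induct)
  case (step n)
  then show ?case using gap[of n] by fastforce
qed simp

lemma zmod_end: "j \<le> m \<Longrightarrow> zmod m \<phi> (\<phi> j) = 0"
  using zmod_zero[of j m \<phi>] zmod_zero[of 0 m \<phi>] zmod_periodic1[of m \<phi> "\<phi> 0"] wrap m
  by (cases "j = m") auto

text \<open>The strict inequality \<open>g < h\<close> separates the two crossings from
  \<open>c j\<close>, and hence from each other, even if the gap only touches the level h.\<close>

lemma level_points:
  assumes "0 < g" "g < h" "j < m"
  shows "\<exists>x. \<phi> j < x \<and> x < c j \<and> zmod m \<phi> x = g" "\<exists>x. c j < x \<and> x < \<phi> (Suc j) \<and> zmod m \<phi> x = g"
proof -
  have ends: "zmod m \<phi> (\<phi> j) = 0" "zmod m \<phi> (\<phi> (Suc j)) = 0" using zmod_end assms(3) by auto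
  have c: "g < zmod m \<phi> (c j)" using peak[OF assms(3)] assms by simp
  obtain x where "\<phi> j \<le> x" "x \<le> c j" "zmod m \<phi> x = g"
    using IVT'[of "zmod m \<phi>" "\<phi> j" g "c j"] ends c assms gap[OF assms(3)] continuous_zmod by force
  then show "\<exists>x. \<phi> j < x \<and> x < c j \<and> zmod m \<phi> x = g"
    using ends c assms by (intro exI[of _ x]) (auto simp: less_le)
  obtain x where "c j \<le> x" "x \<le> \<phi> (Suc j)" "zmod m \<phi> x = g"
    using IVT2'[of "zmod m \<phi>" "\<phi> (Suc j)" g "c j"] ends c assms gap[OF assms(3)] continuous_zmod by force
  then show "\<exists>x. c j < x \<and> x < \<phi> (Suc j) \<and> zmod m \<phi> x = g"
    using ends c assms by (intro exI[of _ x]) (auto simp: less_le)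
qed

text \<open>For g < h the level g is attained at 2 m points of the circle, which exhausts the roots
  of p^2 - g^2 z^m. The case g = h follows since a non-constant holomorphic map is open.\<close>

lemma no_level_in_disc:
  fixes p :: "complex poly"
  assumes deg: "degree p \<le> m" and p0: "poly p 0 \<noteq> 0"
    and p: "\<And>z. cmod z = 1 \<Longrightarrow> (poly p z)\<^sup>2 = z ^ m * of_real ((cmod (poly p z))\<^sup>2)"
    and pz: "\<And>t. cmod (poly p (cis t)) = zmod m \<phi> t"
    and z: "cmod z < 1"
  shows "(poly p z)\<^sup>2 \<noteq> of_real (h\<^sup>2) * z ^ m"
proof
  have below: "(poly p z)\<^sup>2 \<noteq> of_real (g\<^sup>2) * z ^ m" if g: "0 < g" "g < h" and z: "cmod z < 1" for g z
  proof
    assume root: "(poly p z)\<^sup>2 = of_real (g\<^sup>2) * z ^ m"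
    define M where "M = p ^ 2 - monom (of_real (g\<^sup>2)) m"
    have M: "poly M z = (poly p z)\<^sup>2 - of_real (g\<^sup>2) * z ^ m" for z
      by (simp add: M_def poly_monom)
    have "poly M 0 \<noteq> 0" using p0 m by (simp add: M power_0_left)
    then have M0: "M \<noteq> 0" by auto
    have degM: "degree M \<le> 2 * m"
      unfolding M_def power2_eq_square
      by (intro degree_diff_le order_trans[OF degree_mult_le] order_trans[OF degree_monom_le]) (use deg in auto)
    obtain x where x: "\<And>j. j < m \<Longrightarrow> \<phi> j < x j \<and> x j < c j \<and> zmod m \<phi> (x j) = g"
      using level_points(1)[OF g] by metis
    obtain y where y: "\<And>j. j < m \<Longrightarrow> c j < y j \<and> y j < \<phi> (Suc j) \<and> zmod m \<phi> (y j) = g"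
      using level_points(2)[OF g] by metis
    define pt where "pt i = (if snd i then x (fst i) else y (fst i))" for i
    let ?I = "{..<m} \<times> (UNIV :: bool set)"
    have pt: "\<phi> (fst i) < pt i" "pt i < \<phi> (Suc (fst i))" "zmod m \<phi> (pt i) = g" if "i \<in> ?I" for i
      using x[of "fst i"] y[of "fst i"] gap[of "fst i"] that by (auto simp: pt_def)
    have range: "\<phi> 0 < pt i" "pt i < \<phi> 0 + 2 * pi" if "i \<in> ?I" for i
      using pt[OF that] \<phi>_mono[of 0 "fst i"] \<phi>_mono[of "Suc (fst i)" m] that wrap by auto
    have inj: "inj_on (\<lambda>i. cis (pt i)) ?I"
    proof (rule inj_onI)
      fix i k assume ik: "i \<in> ?I" "k \<in> ?I" and eq: "cis (pt i) = cis (pt k)"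
      have pp: "pt i = pt k"
        by (rule cis_inj_window[OF eq]) (use range[OF ik(1)] range[OF ik(2)] in auto)
      have ff: "fst i = fst k"
      proof (rule ccontr)
        assume "fst i \<noteq> fst k"
        then consider "Suc (fst i) \<le> fst k" | "Suc (fst k) \<le> fst i" by linarith
        then show False
        proof cases
          case 1
          then show False using \<phi>_mono[OF 1] pt[OF ik(1)] pt[OF ik(2)] pp ik by auto
        next
          case 2
          then show False using \<phi>_mono[OF 2] pt[OF ik(1)] pt[OF ik(2)] pp ik by auto
        qed
      qed
      have "x (fst i) < y (fst i)" using x[of "fst i"] y[of "fst i"] ik by auto
      then have "snd i = snd k" using pp ff by (auto simp: pt_def split: if_splits)
      then show "i = k" using ff by (simp add: prod_eq_iff)
    qed
    have sub: "insert z ((\<lambda>i. cis (pt i)) ` ?I) \<subseteq> {w. poly M w = 0}"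
      using root p pt(3) by (auto simp: M pz)
    have "z \<notin> (\<lambda>i. cis (pt i)) ` ?I" using z by auto
    then have "card (insert z ((\<lambda>i. cis (pt i)) ` ?I)) = Suc (2 * m)"
      by (simp add: card_image[OF inj] card_cartesian_product)
    moreover have "card (insert z ((\<lambda>i. cis (pt i)) ` ?I)) \<le> card {w. poly M w = 0}"
      using poly_roots_finite[OF M0] sub by (rule card_mono)
    moreover have "card {w. poly M w = 0} \<le> degree M" using M0 by (rule card_poly_roots_bound)
    ultimately show False using degM by simp
  qed
  assume root: "(poly p z)\<^sup>2 = of_real (h\<^sup>2) * z ^ m"
  have z0: "z \<noteq> 0" using root p0 m by (auto simp: power_0_left)
  \<comment> \<open>Below h no value g^2 is taken by this quotient in the punctured disc. If h^2
    were taken, an open image would also contain slightly smaller values.\<close>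
  define F where "F w = (poly p w)\<^sup>2 / w ^ m" for w
  let ?U = "ball (0::complex) 1 - {0}"
  have op: "open (F ` ?U)"
  proof (rule open_mapping_thm)
    show "F holomorphic_on ?U" unfolding F_def by (intro holomorphic_intros) auto
    show "connected ?U" by (intro connected_punctured_ball) auto
    show "\<not> F constant_on ?U"
    proof
      assume "F constant_on ?U"
      then obtain k where k: "\<And>w. w \<in> ?U \<Longrightarrow> F w = k" by (auto simp: constant_on_def)
      have "?U \<subseteq> {w. poly (p ^ 2 - monom k m) w = 0}"
        using k by (auto simp: F_def poly_monom field_simps)
      moreover have "infinite ?U"
        by (simp add: infinite_remove uncountable_ball uncountable_infinite)
      ultimately have "p ^ 2 - monom k m = 0"
        using poly_roots_finite finite_subset by blast
      then have "poly (p ^ 2 - monom k m) 0 = 0" by simp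
      then show False using p0 m by (simp add: poly_monom power_0_left)
    qed
  qed auto
  have "F z = of_real (h\<^sup>2)" using root z0 by (simp add: F_def)
  then have "of_real (h\<^sup>2) \<in> F ` ?U" using z z0 by (intro image_eqI[of _ _ z]) auto
  from openE[OF op this] obtain e where e: "0 < e" "ball (of_real (h\<^sup>2)) e \<subseteq> F ` ?U"
    by metis
  \<comment> \<open>Small enough for h^2 - d to be positive and to stay in the ball around
    h^2.\<close>
  define d where "d = min (e / 2) (h\<^sup>2 / 2)"
  have d: "0 < d" "d < e" "d < h\<^sup>2" using e h by (auto simp: d_def min_def)
  define g where "g = sqrt (h\<^sup>2 - d)"
  have g: "0 < g" "g\<^sup>2 = h\<^sup>2 - d" using d by (auto simp: g_def)
  have "g\<^sup>2 < h\<^sup>2" using g d by simp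
  then have "g < h" using h by (simp add: power2_less_imp_less)
  have "of_real (g\<^sup>2) \<in> ball (of_real (h\<^sup>2) :: complex) e"
    unfolding mem_ball dist_of_real using g d by (simp add: dist_real_def)
  then obtain w where w: "w \<in> ?U" "F w = of_real (g\<^sup>2)" using e by (metis imageE subsetD)
  then have "(poly p w)\<^sup>2 = of_real (g\<^sup>2) * w ^ m" by (simp add: F_def field_simps)
  then show False using below[OF g(1) \<open>g < h\<close>, of w] w by auto
qed

end

section \<open>The superlevel set between adjacent zeros\<close>

text \<open>A positive product puts both half angles on the same branch of the cotangent, where cot
  u - cot v = sin (v - u) / (sin u sin v).\<close>

lemma cot_half_strict_decreasing:
  assumes "x < y" "y - x < 2 * pi" "0 < x * y" "\<bar>x\<bar> < 2 * pi" "\<bar>y\<bar> < 2 * pi"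
  shows "cot (y / 2) < cot (x / 2)"
proof -
  have "0 < sin (x / 2) / sin (y / 2)" by (rule sin_half_ratio_pos) (use assms in auto)
  then have p: "0 < sin (x / 2) * sin (y / 2)" by (simp add: zero_less_divide_iff zero_less_mult_iff)
  have "0 < sin (y / 2 - x / 2)" using assms by (intro sin_gt_zero) auto
  with p have "0 < sin (y / 2 - x / 2) / (sin (x / 2) * sin (y / 2))" by simp
  also have "\<dots> = cot (x / 2) - cot (y / 2)"
    unfolding sin_diff cot_def using p by (auto simp: diff_divide_distrib)
  finally show ?thesis by simp
qed

context separated_zeros
begin

lemma gap_range:
  assumes "j < m" "\<phi> j < t" "t < \<phi> (Suc j)" "i < m"
  shows "\<bar>t - \<phi> i\<bar> < 2 * pi" "if i \<le> j then 0 < t - \<phi> i else t - \<phi> i < 0"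
proof -
  have "\<phi> 0 \<le> \<phi> j" "\<phi> (Suc j) \<le> \<phi> m" "\<phi> 0 \<le> \<phi> i" using \<phi>_mono assms by auto
  moreover have "\<phi> i < \<phi> m" using \<phi>_mono[of "Suc i" m] gap[OF assms(4)] assms by auto
  moreover have "i \<le> j \<Longrightarrow> \<phi> i \<le> \<phi> j" "\<not> i \<le> j \<Longrightarrow> \<phi> (Suc j) \<le> \<phi> i"
    using \<phi>_mono assms by auto
  ultimately show "\<bar>t - \<phi> i\<bar> < 2 * pi" "if i \<le> j then 0 < t - \<phi> i else t - \<phi> i < 0"
    using assms wrap by auto
qed

lemma zmod_pos:
  assumes "j < m" "\<phi> j < t" "t < \<phi> (Suc j)"
  shows "0 < zmod m \<phi> t"
  unfolding zmod_eq
proof (rule prod_pos)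
  fix i assume "i \<in> {..<m}"
  then show "0 < 2 * \<bar>sin ((t - \<phi> i) / 2)\<bar>"
    using gap_range[OF assms, of i] sin_half_pos_iff[of "t - \<phi> i"] sin_half_neg_iff[of "t - \<phi> i"]
    by (auto split: if_splits)
qed

text \<open>Squared sines replace absolute values, so every summand is differentiable; the sum is
  twice the logarithm of \<open>zmod\<close>.\<close>

lemma ln_zmod_DERIV:
  assumes "j < m" "\<phi> j < t" "t < \<phi> (Suc j)"
  shows "((\<lambda>t. \<Sum>i<m. ln (4 * (sin ((t - \<phi> i) / 2))\<^sup>2)) has_real_derivative (\<Sum>i<m. cot ((t - \<phi> i) / 2))) (at t)"
proof (rule DERIV_sum)
  fix i assume "i \<in> {..<m}"
  then have nz: "sin ((t - \<phi> i) / 2) \<noteq> 0"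
    using gap_range[OF assms, of i] sin_half_pos_iff[of "t - \<phi> i"] sin_half_neg_iff[of "t - \<phi> i"]
    by (auto split: if_splits)
  have "((\<lambda>t. ln (4 * (sin ((t - \<phi> i) / 2))\<^sup>2)) has_real_derivative
      (4 * (2 * sin ((t - \<phi> i) / 2) * (cos ((t - \<phi> i) / 2) * (1 / 2)))) / (4 * (sin ((t - \<phi> i) / 2))\<^sup>2)) (at t)"
    using nz by (auto intro!: derivative_eq_intros)
  then show "((\<lambda>t. ln (4 * (sin ((t - \<phi> i) / 2))\<^sup>2)) has_real_derivative cot ((t - \<phi> i) / 2)) (at t)"
    using nz by (simp add: cot_def power2_eq_square)
qed

lemma ln_zmod:
  assumes "j < m" "\<phi> j < t" "t < \<phi> (Suc j)"
  shows "(\<Sum>i<m. ln (4 * (sin ((t - \<phi> i) / 2))\<^sup>2)) = 2 * ln (zmod m \<phi> t)"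
proof -
  have nz: "sin ((t - \<phi> i) / 2) \<noteq> 0" if "i < m" for i
    using that gap_range[OF assms, of i] sin_half_pos_iff[of "t - \<phi> i"] sin_half_neg_iff[of "t - \<phi> i"]
    by (auto split: if_splits)
  have "ln (4 * (sin ((t - \<phi> i) / 2))\<^sup>2) = 2 * ln (2 * \<bar>sin ((t - \<phi> i) / 2)\<bar>)" if "i < m" for i
  proof -
    have "4 * (sin ((t - \<phi> i) / 2))\<^sup>2 = (2 * \<bar>sin ((t - \<phi> i) / 2)\<bar>)\<^sup>2" by (simp add: power_mult_distrib)
    then show ?thesis using nz[OF that] by (simp only: ln_realpow)
  qed
  then show ?thesis unfolding zmod_eq using nz by (subst ln_prod) (auto simp: sum_distrib_left)
qed

text \<open>ln |P| is strictly concave between adjacent zeros, its derivative being a sum of cotangents.\<close>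

lemma no_dip:
  assumes j: "j < m" and "\<phi> j < x" "x < y" "y < z" "z < \<phi> (Suc j)"
    and le: "zmod m \<phi> y \<le> zmod m \<phi> x" "zmod m \<phi> y \<le> zmod m \<phi> z"
  shows False
proof -
  define u where "u t = (\<Sum>i<m. ln (4 * (sin ((t - \<phi> i) / 2))\<^sup>2))" for t
  define u' where "u' t = (\<Sum>i<m. cot ((t - \<phi> i) / 2))" for t
  have D: "(u has_real_derivative u' t) (at t)" if "\<phi> j < t" "t < \<phi> (Suc j)" for t
    unfolding u_def u'_def by (rule ln_zmod_DERIV[OF j that])
  have u: "u t = 2 * ln (zmod m \<phi> t)" "0 < zmod m \<phi> t" if "\<phi> j < t" "t < \<phi> (Suc j)" for t
    unfolding u_def using ln_zmod[OF j that] zmod_pos[OF j that] by auto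
  have u_le: "u y \<le> u x" "u y \<le> u z" using u[of x] u[of y] u[of z] le assms by auto
  obtain \<xi> where \<xi>: "x < \<xi>" "\<xi> < y" "u y - u x = (y - x) * u' \<xi>"
    using MVT2[of x y u u'] D assms by auto
  obtain \<eta> where \<eta>: "y < \<eta>" "\<eta> < z" "u z - u y = (z - y) * u' \<eta>"
    using MVT2[of y z u u'] D assms by auto
  have "u' \<xi> \<le> 0" using \<xi> u_le assms by (smt (verit) mult_pos_pos)
  moreover have "0 \<le> u' \<eta>" using \<eta> u_le assms by (smt (verit) mult_pos_neg)
  moreover have "u' \<eta> < u' \<xi>"
    unfolding u'_def
  proof (rule sum_strict_mono)
    fix i assume "i \<in> {..<m}"
    then have i: "i < m" by simp
    show "cot ((\<eta> - \<phi> i) / 2) < cot ((\<xi> - \<phi> i) / 2)"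
    proof (rule cot_half_strict_decreasing)
      have "\<phi> 0 \<le> \<phi> j" "\<phi> (Suc j) \<le> \<phi> m" using \<phi>_mono j by auto
      then show "\<eta> - \<phi> i - (\<xi> - \<phi> i) < 2 * pi" using assms \<xi> \<eta> wrap by auto
      show "0 < (\<xi> - \<phi> i) * (\<eta> - \<phi> i)" "\<bar>\<xi> - \<phi> i\<bar> < 2 * pi" "\<bar>\<eta> - \<phi> i\<bar> < 2 * pi"
        using gap_range[OF j _ _ i, of \<xi>] gap_range[OF j _ _ i, of \<eta>] \<xi> \<eta> assms
        by (auto simp: zero_less_mult_iff split: if_splits)
    qed (use \<xi> \<eta> in auto)
  qed (use j in auto)
  ultimately show False by simp
qed

text \<open>The numbers a and b are the extreme points of a compact set. Between them the value
  cannot drop to h without a dip, which concavity of the logarithm excludes. The level may be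
  touched at one point only, hence \<open>a \<le> b\<close>.\<close>

lemma gap_superlevel:
  assumes j: "j < m"
  shows "\<exists>a b. \<phi> j < a \<and> a \<le> b \<and> b < \<phi> (Suc j) \<and> zmod m \<phi> a = h \<and> zmod m \<phi> b = h \<and>
    (\<forall>t. a < t \<and> t < b \<longrightarrow> h < zmod m \<phi> t) \<and>
    (\<forall>t. \<phi> j \<le> t \<and> t \<le> \<phi> (Suc j) \<and> h \<le> zmod m \<phi> t \<longrightarrow> a \<le> t \<and> t \<le> b)"
proof -
  define S where "S = {t \<in> {\<phi> j..\<phi> (Suc j)}. h \<le> zmod m \<phi> t}"
  have ends: "zmod m \<phi> (\<phi> j) = 0" "zmod m \<phi> (\<phi> (Suc j)) = 0" using zmod_end j by auto
  have "closed S"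
  proof -
    have "S = {\<phi> j..\<phi> (Suc j)} \<inter> {t. h \<le> zmod m \<phi> t}" by (auto simp: S_def)
    then show ?thesis by (auto intro!: closed_Int closed_Collect_le continuous_intros)
  qed
  then have "compact S" by (auto simp: S_def compact_eq_bounded_closed intro: bounded_subset[of "{\<phi> j..\<phi> (Suc j)}"])
  moreover have "S \<noteq> {}" using peak[OF j] gap[OF j] by (auto simp: S_def intro!: exI[of _ "c j"])
  ultimately obtain a b where a: "a \<in> S" "\<And>t. t \<in> S \<Longrightarrow> a \<le> t" and b: "b \<in> S" "\<And>t. t \<in> S \<Longrightarrow> t \<le> b"
    using compact_attains_inf compact_attains_sup by metis
  have aS: "\<phi> j \<le> a" "a \<le> \<phi> (Suc j)" "h \<le> zmod m \<phi> a" using a by (auto simp: S_def)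
  have bS: "\<phi> j \<le> b" "b \<le> \<phi> (Suc j)" "h \<le> zmod m \<phi> b" using b by (auto simp: S_def)
  have strict: "\<phi> j < a" "b < \<phi> (Suc j)" using aS bS ends h by (auto simp: less_le)
  obtain x where x: "\<phi> j \<le> x" "x \<le> a" "zmod m \<phi> x = h"
    using IVT'[of "zmod m \<phi>" "\<phi> j" h a] ends aS h continuous_zmod by force
  then have "x \<in> S" using aS by (simp add: S_def)
  then have fa: "zmod m \<phi> a = h" using a(2) x by force
  obtain y where y: "b \<le> y" "y \<le> \<phi> (Suc j)" "zmod m \<phi> y = h"
    using IVT2'[of "zmod m \<phi>" "\<phi> (Suc j)" h b] ends bS h continuous_zmod by force
  then have "y \<in> S" using bS by (simp add: S_def)
  then have fb: "zmod m \<phi> b = h" using b(2) y by force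
  have "h < zmod m \<phi> t" if "a < t" "t < b" for t
    using no_dip[OF j strict(1) that strict(2)] fa fb by force
  then show ?thesis using strict fa fb a b by (intro exI[of _ a] exI[of _ b]) (auto simp: S_def)
qed

end

section \<open>Moving zeros apart\<close>

lemma superlevel_zpoly: "superlevel (zpoly m \<phi>) h = {t \<in> {0..<2 * pi}. h \<le> zmod m \<phi> t}"
  by (simp add: superlevel_def zmod_def)

lemma superlevel_lmeasurable: "superlevel P h \<in> lmeasurable"
proof -
  have "closed {t. h \<le> cmod (poly P (cis t))}"
    by (intro closed_Collect_le continuous_intros)
  then have "{0..<2 * pi} \<inter> {t. h \<le> cmod (poly P (cis t))} \<in> sets lebesgue"
    by (intro sets.Int) (auto intro!: borel_closed)
  moreover have eq: "superlevel P h = {0..<2 * pi} \<inter> {t. h \<le> cmod (poly P (cis t))}"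
    by (auto simp: superlevel_def)
  moreover have "bounded (superlevel P h)"
    unfolding eq by (rule bounded_subset[of "{0..2 * pi}"]) auto
  ultimately show ?thesis using bounded_set_imp_lmeasurable by metis
qed

lemma shift_to_window:
  obtains k :: int where "x \<le> t + 2 * pi * of_int k" "t + 2 * pi * of_int k < x + 2 * pi"
proof
  define k where "k = - \<lfloor>(t - x) / (2 * pi)\<rfloor>"
  define y where "y = (t - x) / (2 * pi)"
  have t: "t = x + 2 * pi * y" by (simp add: y_def)
  have k: "t + 2 * pi * of_int k = x + 2 * pi * (y - of_int \<lfloor>y\<rfloor>)"
    by (simp add: k_def y_def[symmetric]) (simp add: t algebra_simps)
  have "0 \<le> y - of_int \<lfloor>y\<rfloor>" "y - of_int \<lfloor>y\<rfloor> < 1" by linarith+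
  then show "x \<le> t + 2 * pi * of_int k" "t + 2 * pi * of_int k < x + 2 * pi"
    unfolding k by auto
qed

text \<open>Inclusion alone gives only a weak inequality. The last point s before a point above the
  level where the old function is at most h has new value strictly below h. Just to the right of s
  the old function exceeds h while the new one is still below it, so a whole interval is
  lost.\<close>

lemma measure_superlevel_strict_mono:
  assumes pos: "0 < h" and z: "zmod m \<phi> x = 0" and big: "h < zmod m \<phi> t0"
    and lt: "\<And>t. h \<le> zmod m \<phi> t \<Longrightarrow> zmod m \<psi> t < zmod m \<phi> t"
    and sub: "\<And>t. h \<le> zmod m \<psi> t \<Longrightarrow> h \<le> zmod m \<phi> t"
  shows "measure lebesgue (superlevel (zpoly m \<psi>) h) < measure lebesgue (superlevel (zpoly m \<phi>) h)"
proof -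
  let ?f = "zmod m \<phi>" and ?g = "zmod m \<psi>"
  obtain k :: int where k: "x \<le> t0 + 2 * pi * of_int k" by (rule shift_to_window)
  define T where "T = t0 + 2 * pi * of_int k"
  have T: "h < ?f T" "x \<le> T" using big k zmod_periodic by (simp_all add: T_def)
  have gf: "?g s < h" if "?f s \<le> h" for s
    using that lt[of s] sub[of s] by force
  define S where "S = {x..T} \<inter> {t. ?f t \<le> h}"
  have "compact S"
    unfolding S_def by (intro compact_Int_closed closed_Collect_le continuous_intros) auto
  moreover have "x \<in> S" using z pos T by (simp add: S_def)
  ultimately obtain s where s: "s \<in> S" "\<And>t. t \<in> S \<Longrightarrow> t \<le> s"
    using compact_attains_sup[of S] by blast
  have sT: "s < T" using s(1) T by (auto simp: S_def less_le)
  have "open {t. ?g t < h}" by (intro open_Collect_less continuous_intros)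
  moreover have "s \<in> {t. ?g t < h}" using s(1) gf by (auto simp: S_def)
  ultimately obtain e where e: "0 < e" "ball s e \<subseteq> {t. ?g t < h}" by (auto simp: open_contains_ball)
  define t1 where "t1 = min (s + e / 2) T"
  have t1: "s < t1" "t1 \<le> T" "dist s t1 < e" using sT e by (auto simp: t1_def dist_real_def)
  then have "?g t1 < h" using e by auto
  moreover have "h < ?f t1"
    using s(2)[of t1] t1 s(1) by (force simp: S_def)
  moreover obtain l :: int where "0 \<le> t1 + 2 * pi * of_int l" "t1 + 2 * pi * of_int l < 0 + 2 * pi"
    by (rule shift_to_window)
  ultimately obtain u where u: "0 \<le> u" "u < 2 * pi" "?g u < h" "h < ?f u"
    using zmod_periodic by force
  have "open ({t. ?g t < h} \<inter> {t. h < ?f t})" by (intro open_Int open_Collect_less continuous_intros)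
  moreover have "u \<in> {t. ?g t < h} \<inter> {t. h < ?f t}" using u by simp
  ultimately obtain d where d: "0 < d" "ball u d \<subseteq> {t. ?g t < h} \<inter> {t. h < ?f t}"
    by (rule openE)
  define v where "v = min (u + d) (2 * pi)"
  have uv: "u < v" using u d by (simp add: v_def)
  have iv: "?g t < h \<and> h < ?f t \<and> 0 \<le> t \<and> t < 2 * pi" if "u < t" "t < v" for t
  proof -
    have "t \<in> ball u d" using that by (auto simp: v_def dist_real_def)
    then show ?thesis using d(2) that u by (auto simp: v_def)
  qed
  let ?E = "superlevel (zpoly m \<phi>) h" and ?E' = "superlevel (zpoly m \<psi>) h"
  have "measure lebesgue ?E' < measure lebesgue ?E' + measure lebesgue {u<..<v}" using uv by simp
  also have "\<dots> = measure lebesgue (?E' \<union> {u<..<v})"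
  proof -
    have "?E' \<inter> {u<..<v} = {}" using iv by (force simp: superlevel_zpoly)
    then show ?thesis
      using measure_Un3[OF superlevel_lmeasurable[of "zpoly m \<psi>" h], of "{u<..<v}"] by simp
  qed
  also have "\<dots> \<le> measure lebesgue ?E"
  proof (rule measure_mono_fmeasurable)
    show "?E' \<union> {u<..<v} \<subseteq> ?E" using iv sub by (force simp: superlevel_zpoly)
    show "?E' \<union> {u<..<v} \<in> sets lebesgue"
      using superlevel_lmeasurable by (auto intro: fmeasurableD)
  qed (rule superlevel_lmeasurable)
  finally show ?thesis .
qed

text \<open>The two factors depend on the zeros only through their midpoint and half distance. A
  symmetric displacement therefore changes nothing but the constant cosine.\<close>

lemma zmod_split2:
  assumes ij: "i < m" "j < m" "i \<noteq> j"
  shows "zmod m \<phi> t = (\<Prod>l\<in>{..<m} - {i, j}. 2 * \<bar>sin ((t - \<phi> l) / 2)\<bar>) *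
    (2 * \<bar>cos ((\<phi> j - \<phi> i) / 2) - cos (t - (\<phi> i + \<phi> j) / 2)\<bar>)"
proof -
  let ?s = "\<lambda>l. 2 * \<bar>sin ((t - \<phi> l) / 2)\<bar>"
  have "prod ?s {..<m} = ?s i * prod ?s ({..<m} - {i})"
    using ij by (intro prod.remove) auto
  also have "prod ?s ({..<m} - {i}) = ?s j * prod ?s ({..<m} - {i} - {j})"
    using ij by (intro prod.remove) auto
  also have "{..<m} - {i} - {j} = {..<m} - {i, j}" by auto
  finally have "zmod m \<phi> t = (?s i * ?s j) * prod ?s ({..<m} - {i, j})"
    by (simp only: zmod_eq mult.assoc)
  moreover have "?s i * ?s j = 2 * \<bar>cos ((\<phi> j - \<phi> i) / 2) - cos (t - (\<phi> i + \<phi> j) / 2)\<bar>"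
  proof -
    have 1: "(t - \<phi> i) / 2 - (t - \<phi> j) / 2 = (\<phi> j - \<phi> i) / 2" "(t - \<phi> i) / 2 + (t - \<phi> j) / 2 = t - (\<phi> i + \<phi> j) / 2"
      by (simp_all add: field_simps)
    have "?s i * ?s j = 4 * \<bar>sin ((t - \<phi> i) / 2) * sin ((t - \<phi> j) / 2)\<bar>" by (simp add: abs_mult)
    also have "\<dots> = 2 * \<bar>cos ((\<phi> j - \<phi> i) / 2) - cos (t - (\<phi> i + \<phi> j) / 2)\<bar>"
      unfolding sin_times_sin 1 by simp
    finally show ?thesis .
  qed
  ultimately show ?thesis by (simp only: mult.commute)
qed

text \<open>Moving two zeros apart symmetrically lowers |P| off the arc between them.\<close>

lemma move_zeros_apart:
  assumes ij: "i < m" "j < m" "i \<noteq> j" and le: "\<phi> i \<le> \<phi> j" "\<phi> j < \<phi> i + 2 * pi" and h: "0 < h"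
    and low: "\<And>t. \<phi> i \<le> t \<Longrightarrow> t \<le> \<phi> j \<Longrightarrow> zmod m \<phi> t < h"
    and big: "h < zmod m \<phi> t0"
  shows "\<exists>\<psi>. measure lebesgue (superlevel (zpoly m \<psi>) h) < measure lebesgue (superlevel (zpoly m \<phi>) h)"
proof -
  let ?f = "zmod m \<phi>"
  define d \<mu> where "d = (\<phi> j - \<phi> i) / 2" and "\<mu> = (\<phi> i + \<phi> j) / 2"
  have d: "0 \<le> d" "d < pi" using le by (auto simp: d_def)
  have xy: "\<phi> i = \<mu> - d" "\<phi> j = \<mu> + d" by (simp_all add: d_def \<mu>_def field_simps)
  have f0: "?f (\<phi> i) = 0" "?f (\<phi> j) = 0" using zmod_zero ij by auto
  obtain t2 where t2: "\<phi> i \<le> t2" "t2 \<le> \<phi> j" "\<And>t. \<phi> i \<le> t \<Longrightarrow> t \<le> \<phi> j \<Longrightarrow> ?f t \<le> ?f t2"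
    using continuous_attains_sup[of "{\<phi> i..\<phi> j}" ?f] continuous_zmod le by auto
  \<comment> \<open>The maximum with h / 2 keeps \<open>M\<close> positive, so that |P| <
    \<open>M\<close> near both zeros.\<close>
  define M where "M = max (?f t2) (h / 2)"
  have M: "M < h" "0 < M" using low[OF t2(1,2)] h by (auto simp: M_def)
  have op: "open {t. ?f t < M}" by (intro open_Collect_less continuous_intros)
  have "\<phi> i \<in> {t. ?f t < M}" "\<phi> j \<in> {t. ?f t < M}" using f0 M by auto
  then obtain e1 e2 where e: "0 < e1" "ball (\<phi> i) e1 \<subseteq> {t. ?f t < M}" "0 < e2" "ball (\<phi> j) e2 \<subseteq> {t. ?f t < M}"
    using op by (meson openE)
  \<comment> \<open>The first two bounds keep |P| at most \<open>M\<close> slightly beyond the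
    zeros, the third keeps the half distance below pi, and the last limits the growth of |P|, which
    is at most 2^m \<epsilon>.\<close>
  define r where "r = Min {e1, e2, pi - d, (h - M) / 2 ^ m}"
  define \<epsilon> where "\<epsilon> = r / 2"
  have "0 < r" using e d M by (simp add: r_def)
  moreover have "r \<le> e1" "r \<le> e2" "r \<le> pi - d" "r \<le> (h - M) / 2 ^ m" by (simp_all add: r_def)
  ultimately have \<epsilon>: "0 < \<epsilon>" "\<epsilon> < e1" "\<epsilon> < e2" "d + \<epsilon> < pi" "\<epsilon> < (h - M) / 2 ^ m"
    unfolding \<epsilon>_def by linarith+
  have \<epsilon>m: "2 ^ m * \<epsilon> < h - M" using \<epsilon>(5) by (simp add: field_simps)
  have near: "?f t \<le> M" if "\<phi> i - \<epsilon> \<le> t" "t \<le> \<phi> j + \<epsilon>" for t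
  proof -
    consider "\<phi> i \<le> t" "t \<le> \<phi> j" | "t < \<phi> i" | "\<phi> j < t" by linarith
    then show ?thesis
    proof cases
      case 1
      then show ?thesis using t2(3)[of t] by (simp add: M_def le_max_iff_disj)
    next
      case 2
      then have "t \<in> ball (\<phi> i) e1" using that \<epsilon>(2) by (simp add: dist_real_def)
      then have "?f t < M" using e(2) by auto
      then show ?thesis by simp
    next
      case 3
      then have "t \<in> ball (\<phi> j) e2" using that \<epsilon>(3) by (simp add: dist_real_def)
      then have "?f t < M" using e(4) by auto
      then show ?thesis by simp
    qed
  qed
  define \<psi> where "\<psi> = \<phi>(i := \<phi> i - \<epsilon>, j := \<phi> j + \<epsilon>)"
  let ?g = "zmod m \<psi>"
  define K where "K t = (\<Prod>l\<in>{..<m} - {i, j}. 2 * \<bar>sin ((t - \<phi> l) / 2)\<bar>)" for t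
  have K0: "0 \<le> K t" for t unfolding K_def by (intro prod_nonneg) auto
  have f: "?f t = K t * (2 * \<bar>cos d - cos (t - \<mu>)\<bar>)" for t
    unfolding zmod_split2[OF ij] K_def d_def \<mu>_def ..
  have g: "?g t = K t * (2 * \<bar>cos (d + \<epsilon>) - cos (t - \<mu>)\<bar>)" for t
  proof -
    have "(\<Prod>l\<in>{..<m} - {i, j}. 2 * \<bar>sin ((t - \<psi> l) / 2)\<bar>) = K t"
      unfolding K_def by (rule prod.cong) (auto simp: \<psi>_def)
    moreover have "(\<psi> j - \<psi> i) / 2 = d + \<epsilon>" "(\<psi> i + \<psi> j) / 2 = \<mu>"
      using ij by (auto simp: \<psi>_def d_def \<mu>_def field_simps)
    ultimately show ?thesis unfolding zmod_split2[OF ij] by (simp only:)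
  qed
  have K_le: "K t * 2 \<le> 2 ^ m" for t
  proof -
    have "K t \<le> (\<Prod>l\<in>{..<m} - {i, j}. 2)" unfolding K_def by (rule prod_mono) auto
    also have "\<dots> = 2 ^ (m - 2)" using ij by (simp add: card_Diff_subset)
    finally have "K t * 2 \<le> 2 ^ (m - 2) * 2" by simp
    also have "\<dots> \<le> 2 ^ m" using ij by (subst power_Suc2[symmetric]) (intro power_increasing, auto)
    finally show ?thesis .
  qed
  have cosd: "cos (d + \<epsilon>) < cos d" using d \<epsilon> by (intro cos_monotone_0_pi) auto
  have cos_close: "cos d - cos (d + \<epsilon>) \<le> \<epsilon>"
  proof -
    obtain \<xi> where "cos (d + \<epsilon>) - cos d = (d + \<epsilon> - d) * - sin \<xi>"
      using MVT2[of d "d + \<epsilon>" cos "\<lambda>x. - sin x"] \<epsilon> by (auto intro: DERIV_cos)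
    then have "cos d - cos (d + \<epsilon>) = \<epsilon> * sin \<xi>" by simp
    also have "\<dots> \<le> \<epsilon> * 1" using \<epsilon> by (intro mult_left_mono) auto
    finally show ?thesis by simp
  qed
  \<comment> \<open>The condition describes the arc between the displaced zeros. There |P| was at
    most \<open>M\<close>, and the displacement adds less than h - \<open>M\<close>.\<close>
  have inside: "?f t < h \<and> ?g t < h" if t: "cos (d + \<epsilon>) < cos (t - \<mu>)" for t
  proof -
    obtain k :: int where k: "\<mu> - pi \<le> t + 2 * pi * of_int k" "t + 2 * pi * of_int k < \<mu> - pi + 2 * pi"
      by (rule shift_to_window)
    define u where "u = t + 2 * pi * of_int k"
    have "cos (u - \<mu>) = cos (t - \<mu>)"
      using cis_periodic_int[of "t - \<mu>" k] by (auto simp: u_def complex_eq_iff algebra_simps)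
    then have cu: "cos (d + \<epsilon>) < cos \<bar>u - \<mu>\<bar>" using t by simp
    have "\<bar>u - \<mu>\<bar> < d + \<epsilon>"
    proof (rule ccontr)
      assume "\<not> \<bar>u - \<mu>\<bar> < d + \<epsilon>"
      then have "cos \<bar>u - \<mu>\<bar> \<le> cos (d + \<epsilon>)"
        using d \<epsilon> k by (intro cos_monotone_0_pi_le) (auto simp: u_def abs_le_iff)
      with cu show False by simp
    qed
    then have fu: "?f u \<le> M" using near[of u] by (auto simp: xy abs_less_iff)
    have "\<bar>cos (d + \<epsilon>) - cos (u - \<mu>)\<bar> \<le> \<bar>cos d - cos (u - \<mu>)\<bar> + \<epsilon>" using cos_close cosd by linarith
    then have "K u * 2 * \<bar>cos (d + \<epsilon>) - cos (u - \<mu>)\<bar> \<le> K u * 2 * (\<bar>cos d - cos (u - \<mu>)\<bar> + \<epsilon>)"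
      using K0 by (intro mult_left_mono) auto
    then have "?g u \<le> ?f u + K u * 2 * \<epsilon>" unfolding f g by (simp add: algebra_simps)
    also have "K u * 2 * \<epsilon> \<le> 2 ^ m * \<epsilon>" using K_le \<epsilon> by (intro mult_right_mono) auto
    finally have "?g u < h" using fu \<epsilon>m by linarith
    moreover have "?f u < h" using fu M by simp
    ultimately show ?thesis unfolding u_def zmod_periodic by simp
  qed
  \<comment> \<open>Here cos (t - \<mu>) is at most the new constant cosine, which is below the old
    one; the distance to it shrinks.\<close>
  have outside: "?g t \<le> ?f t \<and> (0 < ?f t \<longrightarrow> ?g t < ?f t)" if t: "\<not> cos (d + \<epsilon>) < cos (t - \<mu>)" for t
  proof -
    have "\<bar>cos (d + \<epsilon>) - cos (t - \<mu>)\<bar> < \<bar>cos d - cos (t - \<mu>)\<bar>" using t cosd by linarith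
    moreover have "0 < K t" if "0 < ?f t" using that K0[of t] unfolding f by (auto simp: less_le)
    ultimately show ?thesis unfolding f g using K0[of t] by (auto intro!: mult_left_mono)
  qed
  have "measure lebesgue (superlevel (zpoly m \<psi>) h) < measure lebesgue (superlevel (zpoly m \<phi>) h)"
  proof (rule measure_superlevel_strict_mono[OF h f0(1) big])
    show "?g t < ?f t" if "h \<le> ?f t" for t using inside[of t] outside[of t] that h by force
    show "h \<le> ?f t" if "h \<le> ?g t" for t using inside[of t] outside[of t] that by force
  qed
  then show ?thesis by blast
qed

text \<open>Averaging over rotated m-th roots of unity leaves only the two extreme coefficients.\<close>

lemma zmod_ge_2:
  assumes m: "1 \<le> m"
  shows "\<exists>t. 2 \<le> zmod m \<phi> t"
proof (rule ccontr)
  assume "\<not> ?thesis"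
  then have small: "zmod m \<phi> t < 2" for t by (meson not_le)
  define P where "P = zpoly m \<phi>"
  have P0: "cmod (poly P 0) = 1" by (simp add: P_def poly_zpoly prod_norm[symmetric])
  have degP: "degree P = m" unfolding P_def zpoly_def by (subst degree_prod_eq_sum_degree) auto
  have lead: "coeff P m = 1"
    using lead_coeff_prod[of "\<lambda>j. [:- cis (\<phi> j), 1:]" "{..<m}"] degP by (simp add: P_def zpoly_def)
  \<comment> \<open>The points \<open>w k\<close> are the m-th roots of P(0), so the leading term
    and the constant term add up in phase.\<close>
  define \<alpha> where "\<alpha> = Arg (poly P 0)"
  have \<alpha>: "cis \<alpha> = poly P 0" unfolding \<alpha>_def using P0 by (metis cis_Arg div_by_1 norm_zero sgn_eq zero_neq_one of_real_1)
  define w where "w k = cis ((\<alpha> + 2 * pi * real k) / m)" for k :: nat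
  have wpow: "(\<Sum>k<m. w k ^ i) = (if i = 0 then of_nat m else if i = m then of_nat m * cis \<alpha> else 0)" if "i \<le> m" for i
  proof -
    define x where "x = cis (2 * pi * real i / m)"
    have wk: "w k ^ i = cis (\<alpha> * i / m) * x ^ k" for k
    proof -
      have "real i * ((\<alpha> + 2 * pi * real k) / m) = \<alpha> * i / m + real k * (2 * pi * real i / m)"
        by (simp add: add_divide_distrib distrib_left mult_ac)
      then show ?thesis by (simp only: w_def x_def Complex.DeMoivre cis_mult)
    qed
    consider "i = 0" | "i = m" | "0 < i" "i < m" using \<open>i \<le> m\<close> by linarith
    then show ?thesis
    proof cases
      case 1 then show ?thesis by simp
    next
      case 2
      then have "x = 1" using m by (simp add: x_def)
      then show ?thesis using 2 m unfolding wk by simp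
    next
      case 3
      have "x \<noteq> 1"
      proof
        assume "x = 1"
        then have "cis (2 * pi * real i / m) = cis 0" by (simp add: x_def)
        then have "2 * pi * real i / m = 0"
          by (rule cis_inj_window) (use 3 in \<open>simp add: field_simps\<close>)
        then show False using 3 by simp
      qed
      moreover have "x ^ m = 1" using m cis_periodic_int[of 0 "int i"] unfolding x_def Complex.DeMoivre by simp
      ultimately have "(\<Sum>k<m. x ^ k) = 0" by (simp add: geometric_sum)
      then show ?thesis using 3 unfolding wk by (simp add: sum_distrib_left[symmetric])
    qed
  qed
  have "(\<Sum>k<m. poly P (w k)) = (\<Sum>i\<le>m. coeff P i * (\<Sum>k<m. w k ^ i))"
    unfolding poly_altdef degP sum_distrib_left by (rule sum.swap)
  also have "\<dots> = (\<Sum>i\<in>{0, m}. coeff P i * (\<Sum>k<m. w k ^ i))"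
    by (rule sum.mono_neutral_right) (auto simp: wpow)
  also have "\<dots> = of_nat m * (2 * cis \<alpha>)"
    using m lead \<alpha> by (simp add: wpow poly_0_coeff_0)
  finally have "2 * real m = cmod (\<Sum>k<m. poly P (w k))" by (simp add: norm_mult)
  also have "\<dots> \<le> (\<Sum>k<m. cmod (poly P (w k)))" by (rule norm_sum)
  also have "\<dots> < (\<Sum>k<m. 2)"
    using small m by (intro sum_strict_mono) (auto simp: P_def w_def zmod_def lessThan_empty_iff)
  finally show False by simp
qed

section \<open>The Chebyshev-type polynomial\<close>

text \<open>The difference of the two monic polynomials has degree below m unless it vanishes, but
  it has m distinct zeros.\<close>

lemma prod_minus_odd_roots:
  assumes m: "1 \<le> m"
  shows "(\<Prod>j<m. w - cis ((2 * real j + 1) * pi / m)) = w ^ m + 1"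
proof -
  define e where "e j = cis ((2 * real j + 1) * pi / m)" for j :: nat
  define D where "D = (\<Prod>j<m. [:- e j, 1:]) - (monom 1 m + 1)"
  have degq: "degree (\<Prod>j<m. [:- e j, 1:]) = m" by (subst degree_prod_eq_sum_degree) auto
  have degp: "degree (monom 1 m + 1 :: complex poly) = m"
    using m by (subst degree_add_eq_left) (auto simp: degree_monom_eq)
  have "coeff (\<Prod>j<m. [:- e j, 1:]) m = 1"
    using lead_coeff_prod[of "\<lambda>j. [:- e j, 1:]" "{..<m}"] degq by simp
  then have coeff: "coeff D m = 0" using m by (simp add: D_def coeff_eq_0)
  have degD: "degree D \<le> m" unfolding D_def using degp degq by (intro degree_diff_le) auto
  have inj: "inj_on e {..<m}"
  proof (rule inj_onI)
    fix i j assume ij: "i \<in> {..<m}" "j \<in> {..<m}" "e i = e j"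
    have "(2 * real i + 1) * pi / m - (2 * real j + 1) * pi / m = 2 * pi * ((real i - real j) / m)"
      by (simp add: diff_divide_distrib[symmetric] algebra_simps)
    moreover have "\<bar>(real i - real j) / m\<bar> < 1" using ij by (auto simp: abs_less_iff divide_simps)
    then have "2 * pi * \<bar>(real i - real j) / m\<bar> < 2 * pi * 1" by (intro mult_strict_left_mono) auto
    ultimately have "\<bar>(2 * real i + 1) * pi / m - (2 * real j + 1) * pi / m\<bar> < 2 * pi"
      by (simp only: abs_mult) simp
    from cis_inj_window[OF _ this] ij(3) m show "i = j" by (auto simp: e_def)
  qed
  have em: "e j ^ m = -1" for j
  proof -
    have "e j ^ m = cis (pi + 2 * pi * of_int (int j))"
    proof -
      have "real m * ((2 * real j + 1) * pi / m) = (2 * real j + 1) * pi" using m by simp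
      also have "\<dots> = pi + 2 * pi * of_int (int j)" by (simp add: algebra_simps)
      finally show ?thesis by (simp only: e_def Complex.DeMoivre)
    qed
    then show ?thesis unfolding cis_periodic_int by simp
  qed
  have "D = 0"
  proof (rule ccontr)
    assume D0: "D \<noteq> 0"
    have "e ` {..<m} \<subseteq> {x. poly D x = 0}"
      using em by (auto simp: D_def poly_prod poly_monom)
    then have "card (e ` {..<m}) \<le> card {x. poly D x = 0}"
      using poly_roots_finite[OF D0] by (intro card_mono)
    also have "\<dots> \<le> degree D" by (rule card_poly_roots_bound[OF D0])
    finally have "degree D = m" using degD by (simp add: card_image[OF inj])
    then show False using coeff D0 by auto
  qed
  then have "poly (\<Prod>j<m. [:- e j, 1:]) w = poly (monom 1 m + 1) w" by (simp add: D_def)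
  then show ?thesis by (simp add: poly_prod poly_monom e_def)
qed

text \<open>The zeros below are those of the Chebyshev-type function h T_m (cos (t / 2) / r) with r^m = h / 2.\<close>

definition cheb_zero :: "nat \<Rightarrow> real \<Rightarrow> nat \<Rightarrow> real" where
  "cheb_zero m r j = 2 * arccos (r * cos ((2 * real j + 1) * pi / (2 * m)))"

text \<open>Reversing the index changes the sign of the cosine. This symmetry of the zeros about pi
  makes |P| even in t.\<close>

lemma cheb_zero_reflect:
  assumes "j < m" "0 < r" "r \<le> 1"
  shows "cheb_zero m r (m - Suc j) = 2 * pi - cheb_zero m r j"
proof -
  define x where "x = cos ((2 * real j + 1) * pi / (2 * m))"
  have "(2 * real (m - Suc j) + 1) * pi / (2 * m) = pi - (2 * real j + 1) * pi / (2 * m)"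
    using assms(1) by (simp add: of_nat_diff field_simps)
  then have c: "cos ((2 * real (m - Suc j) + 1) * pi / (2 * m)) = - x"
    by (simp only: cos_pi_minus x_def)
  have "\<bar>r * x\<bar> \<le> 1"
    using assms by (auto simp: abs_mult x_def intro!: mult_le_one)
  then show ?thesis
    unfolding cheb_zero_def c x_def[symmetric] by (simp add: arccos_minus_abs)
qed

text \<open>The square is formed from one copy of |P| and one reflected copy. The factors at t -
  \<phi> and t + \<phi> then combine into a difference of squared cosines.\<close>

lemma zmod_cheb_sq:
  assumes r: "0 < r" "r \<le> 1"
  shows "(zmod m (cheb_zero m r) t)\<^sup>2 =
    (\<Prod>j<m. 4 * \<bar>(r * cos ((2 * real j + 1) * pi / (2 * m)))\<^sup>2 - (cos (t / 2))\<^sup>2\<bar>)"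
proof -
  let ?\<phi> = "cheb_zero m r"
  have refl: "zmod m ?\<phi> t = (\<Prod>j<m. 2 * \<bar>sin ((t + ?\<phi> j) / 2)\<bar>)"
  proof -
    have "zmod m ?\<phi> t = (\<Prod>j<m. 2 * \<bar>sin ((t - ?\<phi> (m - Suc j)) / 2)\<bar>)"
      unfolding zmod_eq by (rule prod.nat_diff_reindex[symmetric])
    also have "\<dots> = (\<Prod>j<m. 2 * \<bar>sin ((t + ?\<phi> j) / 2)\<bar>)"
    proof (rule prod.cong)
      fix j assume "j \<in> {..<m}"
      then have eq: "(t - ?\<phi> (m - Suc j)) / 2 = (t + ?\<phi> j) / 2 - pi"
        using cheb_zero_reflect[of j m r] r by (simp add: field_simps)
      show "2 * \<bar>sin ((t - ?\<phi> (m - Suc j)) / 2)\<bar> = 2 * \<bar>sin ((t + ?\<phi> j) / 2)\<bar>"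
        unfolding eq by (simp add: sin_diff)
    qed simp
    finally show ?thesis .
  qed
  have "(zmod m ?\<phi> t)\<^sup>2 = (\<Prod>j<m. 2 * \<bar>sin ((t - ?\<phi> j) / 2)\<bar>) * (\<Prod>j<m. 2 * \<bar>sin ((t + ?\<phi> j) / 2)\<bar>)"
    unfolding power2_eq_square by (subst (2) refl) (simp only: zmod_eq)
  also have "\<dots> = (\<Prod>j<m. 4 * \<bar>(r * cos ((2 * real j + 1) * pi / (2 * m)))\<^sup>2 - (cos (t / 2))\<^sup>2\<bar>)"
    unfolding prod.distrib[symmetric]
  proof (rule prod.cong)
    fix j assume "j \<in> {..<m}"
    define y where "y = r * cos ((2 * real j + 1) * pi / (2 * m))"
    have y: "\<bar>y\<bar> \<le> 1" using r by (auto simp: abs_mult y_def intro!: mult_le_one)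
    have \<phi>: "?\<phi> j = 2 * arccos y" by (simp add: cheb_zero_def y_def)
    have "sin ((t - ?\<phi> j) / 2) * sin ((t + ?\<phi> j) / 2) = (cos (?\<phi> j) - cos t) / 2"
      unfolding sin_times_sin by (simp add: field_simps)
    also have "cos (?\<phi> j) = 2 * y\<^sup>2 - 1"
      unfolding \<phi> cos_double_cos using y by (simp add: cos_arccos_abs)
    also have "cos t = 2 * (cos (t / 2))\<^sup>2 - 1"
      using cos_double_cos[of "t / 2"] by simp
    finally have "sin ((t - ?\<phi> j) / 2) * sin ((t + ?\<phi> j) / 2) = y\<^sup>2 - (cos (t / 2))\<^sup>2" by simp
    moreover have "2 * \<bar>sin ((t - ?\<phi> j) / 2)\<bar> * (2 * \<bar>sin ((t + ?\<phi> j) / 2)\<bar>) =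
      4 * \<bar>sin ((t - ?\<phi> j) / 2) * sin ((t + ?\<phi> j) / 2)\<bar>" by (simp add: abs_mult)
    ultimately show "2 * \<bar>sin ((t - ?\<phi> j) / 2)\<bar> * (2 * \<bar>sin ((t + ?\<phi> j) / 2)\<bar>) =
      4 * \<bar>(r * cos ((2 * real j + 1) * pi / (2 * m)))\<^sup>2 - (cos (t / 2))\<^sup>2\<bar>"
      unfolding y_def by simp
  qed simp
  finally show ?thesis .
qed

text \<open>The modulus on the right is 2 |cos (m \<theta>)|, so this is the defining formula of the
  Chebyshev polynomial. It comes from factoring w^m + 1 at w = \<open>cis (2 * \<theta>)\<close> and
  at its conjugate.\<close>

lemma zmod_cheb_inner:
  assumes m: "1 \<le> m" and r: "0 < r" "r \<le> 1" and \<theta>: "cos (t / 2) = r * cos \<theta>"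
  shows "zmod m (cheb_zero m r) t = r ^ m * cmod (cis (2 * \<theta>) ^ m + 1)"
proof -
  define e where "e j = (2 * real j + 1) * pi / m" for j :: nat
  define w where "w = cis (2 * \<theta>)"
  have half: "(2 * real j + 1) * pi / (2 * m) = e j / 2" for j by (simp add: e_def)
  have "4 * \<bar>(r * cos (e j / 2))\<^sup>2 - (cos (t / 2))\<^sup>2\<bar> = r\<^sup>2 * (cmod (w - cis (e j)) * cmod (cnj w - cis (e j)))" for j
  proof -
    have cc: "(cos \<theta>)\<^sup>2 = (1 + cos (2 * \<theta>)) / 2" "(cos (e j / 2))\<^sup>2 = (1 + cos (e j)) / 2"
      using cos_double_cos[of \<theta>] cos_double_cos[of "e j / 2"] by simp_all
    have "4 * ((r * cos (e j / 2))\<^sup>2 - (cos (t / 2))\<^sup>2) = r\<^sup>2 * (2 * cos (e j) - 2 * cos (2 * \<theta>))"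
      unfolding \<theta> power_mult_distrib cc by (simp add: field_simps)
    then have 1: "4 * \<bar>(r * cos (e j / 2))\<^sup>2 - (cos (t / 2))\<^sup>2\<bar> = r\<^sup>2 * \<bar>2 * cos (e j) - 2 * cos (2 * \<theta>)\<bar>"
      by (metis abs_mult abs_numeral abs_power2)
    have "(w - cis (e j)) * (cnj w - cis (e j)) = cis (e j) * of_real (2 * cos (e j) - 2 * cos (2 * \<theta>))"
    proof -
      have "w * cnj w = 1" "w + cnj w = of_real (2 * cos (2 * \<theta>))"
        by (simp_all add: w_def complex_norm_square[symmetric] complex_add_cnj)
      moreover have "1 + (cis (e j))\<^sup>2 = cis (e j) * of_real (2 * cos (e j))"
      proof -
        have "of_real (2 * cos (e j)) = cis (e j) + cis (- e j)" "cis (e j) * cis (- e j) = 1"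
          by (simp_all add: complex_eq_iff cis_mult)
        then show ?thesis by (simp add: distrib_left power2_eq_square)
      qed
      moreover have "(w - x) * (cnj w - x) = w * cnj w + x\<^sup>2 - x * (w + cnj w)" for x
        by (simp add: algebra_simps power2_eq_square)
      ultimately show ?thesis by (simp add: right_diff_distrib)
    qed
    from arg_cong[OF this, of cmod] show ?thesis
      unfolding 1 norm_mult norm_of_real norm_cis by simp
  qed
  then have "(zmod m (cheb_zero m r) t)\<^sup>2 = (\<Prod>j<m. r\<^sup>2 * (cmod (w - cis (e j)) * cmod (cnj w - cis (e j))))"
    unfolding zmod_cheb_sq[OF r] half by simp
  also have "\<dots> = (r ^ m)\<^sup>2 * (cmod (\<Prod>j<m. w - cis (e j)) * cmod (\<Prod>j<m. cnj w - cis (e j)))"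
    by (simp add: prod.distrib prod_norm power_mult[symmetric] mult.commute)
  also have "\<dots> = (r ^ m)\<^sup>2 * (cmod (w ^ m + 1) * cmod (cnj w ^ m + 1))"
    unfolding e_def prod_minus_odd_roots[OF m] ..
  also have "cmod (cnj w ^ m + 1) = cmod (w ^ m + 1)"
    by (metis complex_cnj_add complex_cnj_one complex_cnj_power complex_mod_cnj)
  finally have "(zmod m (cheb_zero m r) t)\<^sup>2 = (r ^ m * cmod (w ^ m + 1))\<^sup>2"
    by (simp add: power2_eq_square mult_ac)
  then show ?thesis
    unfolding w_def using zmod_nonneg r by (simp add: power2_eq_iff_nonneg)
qed

text \<open>With r^m = h / 2 the function 2 r^m |cos (m \<theta>)| has maximum h, so where |cos (t /
  2)| \<le> r the level is reached only at finitely many points. The rest of the circle is two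
  intervals of length 2 arccos r, adjacent modulo 2 pi.\<close>

lemma cheb_measure:
  assumes m: "1 \<le> m" and h: "0 < h" "h < 2"
  shows "measure lebesgue (superlevel (zpoly m (cheb_zero m (root m (h / 2)))) h) \<le> 4 * arccos (root m (h / 2))"
proof -
  define r where "r = root m (h / 2)"
  define A where "A = arccos r"
  have r: "0 < r" "r < 1" "r ^ m = h / 2"
    using m h by (auto simp: r_def)
  have A: "0 < A" "A < pi" "cos A = r"
    using r arccos_bounded[of r] cos_arccos[of r] arccos_lt_bounded[of r] by (auto simp: A_def)
  define F where "F = (\<lambda>k. 2 * arccos (r * cos (pi * real k / m))) ` {..m}"
  have sub: "superlevel (zpoly m (cheb_zero m r)) h \<subseteq> ({0..2 * A} \<union> {2 * pi - 2 * A..2 * pi}) \<union> F"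
  proof
    fix t assume "t \<in> superlevel (zpoly m (cheb_zero m r)) h"
    then have t: "0 \<le> t" "t < 2 * pi" "h \<le> zmod m (cheb_zero m r) t" by (auto simp: superlevel_zpoly)
    consider "t \<le> 2 * A" | "2 * pi - 2 * A \<le> t" | "2 * A < t" "t < 2 * pi - 2 * A" by linarith
    then show "t \<in> ({0..2 * A} \<union> {2 * pi - 2 * A..2 * pi}) \<union> F"
    proof cases
      case 3
      have "cos (t / 2) < cos A" using 3 A t by (intro cos_monotone_0_pi) auto
      moreover have "cos (pi - A) < cos (t / 2)" using 3 A t by (intro cos_monotone_0_pi) auto
      ultimately have c: "\<bar>cos (t / 2) / r\<bar> \<le> 1" using A r by (auto simp: abs_le_iff field_simps)
      define \<theta> where "\<theta> = arccos (cos (t / 2) / r)"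
      have \<theta>: "0 \<le> \<theta>" "\<theta> \<le> pi" "cos (t / 2) = r * cos \<theta>"
        using c r unfolding \<theta>_def
        by (auto simp only: abs_le_iff intro!: arccos_lbound arccos_ubound)
          (use c r in \<open>simp_all add: cos_arccos_abs\<close>)
      have "2 \<le> cmod (cis (2 * \<theta>) ^ m + 1)"
        using t(3) zmod_cheb_inner[OF m r(1) less_imp_le[OF r(2)] \<theta>(3)] h r(3) by simp
      then have "2\<^sup>2 \<le> (cmod (cis (2 * \<theta>) ^ m + 1))\<^sup>2" by (intro power_mono) auto
      also have "\<dots> = 2 + 2 * cos (m * (2 * \<theta>))"
        unfolding Complex.DeMoivre cmod_power2
        using sin_cos_squared_add[of "m * (2 * \<theta>)"] by (simp add: power2_eq_square algebra_simps)
      finally have "cos (m * (2 * \<theta>)) = 1"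
        using cos_le_one[of "m * (2 * \<theta>)"] by simp
      then obtain n :: int where n: "m * (2 * \<theta>) = of_int n * 2 * pi"
        by (auto simp: cos_one_2pi_int)
      then have \<theta>n: "\<theta> = pi * of_int n / m" using m by (simp add: field_simps)
      have "0 \<le> n" "n \<le> int m"
      proof -
        have nm: "of_int n = m * \<theta> / pi" unfolding \<theta>n using m by simp
        have "0 \<le> m * \<theta> / pi" "m * \<theta> / pi \<le> m"
          using \<theta>(1,2) by (auto simp: divide_le_eq intro!: mult_left_mono)
        then show "0 \<le> n" "n \<le> int m" unfolding nm[symmetric] by linarith+
      qed
      then have "\<theta> = pi * real (nat n) / m" "nat n \<le> m" unfolding \<theta>n by auto
      moreover have "t = 2 * arccos (r * cos \<theta>)"
        unfolding \<theta>(3)[symmetric] using t by (simp add: arccos_cos)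
      ultimately show ?thesis unfolding F_def by blast
    qed (use t in auto)
  qed
  have "finite F" by (simp add: F_def)
  then have Fm: "F \<in> lmeasurable" "measure lebesgue F = 0"
    using negligible_finite[of F] negligible_imp_measure0 negligible_iff_measure by auto
  have "measure lebesgue (superlevel (zpoly m (cheb_zero m r)) h) \<le>
      measure lebesgue (({0..2 * A} \<union> {2 * pi - 2 * A..2 * pi}) \<union> F)"
    using sub Fm(1) superlevel_lmeasurable
    by (intro measure_mono_fmeasurable) (auto intro!: fmeasurable.Un intro: fmeasurableD)
  also have "\<dots> \<le> measure lebesgue ({0..2 * A} \<union> {2 * pi - 2 * A..2 * pi}) + measure lebesgue F"
    by (rule measure_Un_le) (use Fm(1) in \<open>auto intro: fmeasurableD\<close>)
  also have "measure lebesgue ({0..2 * A} \<union> {2 * pi - 2 * A..2 * pi}) \<le>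
      measure lebesgue {0..2 * A} + measure lebesgue {2 * pi - 2 * A..2 * pi}"
    by (rule measure_Un_le) auto
  finally show ?thesis using A Fm(2) by (simp add: r_def[symmetric] A_def[symmetric])
qed

section \<open>Gaps between the zeros of a minimizer\<close>

lemma zpoly_mem: "zpoly m \<phi> \<in> unit_circle_polys m"
  by (auto simp: unit_circle_polys_def zpoly_def)

lemma delta_le: "delta m h \<le> measure lebesgue (superlevel (zpoly m \<phi>) h)"
  unfolding delta_def by (rule cInf_lower) (auto simp: zpoly_mem intro!: bdd_belowI[of _ 0])

lemma zpoly_cong: "(\<And>j. j < m \<Longrightarrow> cis (\<phi> j) = cis (\<psi> j)) \<Longrightarrow> zpoly m \<phi> = zpoly m \<psi>"
  by (simp add: zpoly_def)

lemma zmod_cong: "zpoly m \<phi> = zpoly m \<psi> \<Longrightarrow> zmod m \<phi> = zmod m \<psi>"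
  by (simp add: zmod_def fun_eq_iff)

lemma zpoly_sorted:
  obtains \<psi> where "zpoly m \<psi> = zpoly m \<phi>" "\<And>j. j < m \<Longrightarrow> 0 \<le> \<psi> j" "\<And>j. j < m \<Longrightarrow> \<psi> j < 2 * pi"
    "\<And>i j. i \<le> j \<Longrightarrow> j < m \<Longrightarrow> \<psi> i \<le> \<psi> j"
proof -
  have "\<exists>x. 0 \<le> x \<and> x < 2 * pi \<and> cis x = cis (\<phi> j)" for j
    using shift_to_window[of 0 "\<phi> j"] cis_periodic_int by (metis add_0)
  then obtain \<eta> where \<eta>: "\<And>j. 0 \<le> \<eta> j" "\<And>j. \<eta> j < 2 * pi" "\<And>j. cis (\<eta> j) = cis (\<phi> j)" by metis
  define xs where "xs = sort (map \<eta> [0..<m])"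
  have len: "length xs = m" by (simp add: xs_def)
  have mem: "xs ! j \<in> range \<eta>" if "j < m" for j
    using nth_mem[of j xs] that len by (auto simp: xs_def)
  have "zpoly m (\<lambda>j. xs ! j) = prod_list (map (\<lambda>x. [:- cis x, 1:]) xs)"
    by (simp add: zpoly_def prod.list_conv_set_nth len lessThan_atLeast0)
  also have "\<dots> = prod_mset (image_mset (\<lambda>x. [:- cis x, 1:]) (mset xs))"
    by (simp add: prod_mset_prod_list[symmetric])
  also have "\<dots> = prod_list (map (\<lambda>x. [:- cis x, 1:]) (map \<eta> [0..<m]))"
    by (simp add: xs_def prod_mset_prod_list[symmetric] image_mset.compositionality)
  also have "\<dots> = zpoly m \<eta>"
    by (simp add: zpoly_def prod.list_conv_set_nth lessThan_atLeast0)
  also have "\<dots> = zpoly m \<phi>" by (rule zpoly_cong) (rule \<eta>(3))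
  finally have "zpoly m (\<lambda>j. xs ! j) = zpoly m \<phi>" .
  moreover have "sorted xs" by (simp add: xs_def)
  ultimately show thesis
    using that[of "\<lambda>j. xs ! j"] mem \<eta>(1,2) len by (fastforce simp: sorted_nth_mono)
qed

text \<open>A multiple zero appears as a gap of length zero, on which |P| vanishes. The displacement
  argument therefore covers it as well, and simplicity of the zeros needs no separate proof.\<close>

lemma minimizer_separated:
  assumes m: "1 \<le> m" and h: "0 < h" "h < 2"
    and min: "measure lebesgue (superlevel (zpoly m \<phi>) h) = delta m h"
  obtains \<psi> c where "zpoly m \<psi> = zpoly m \<phi>" "0 \<le> \<psi> 0" "\<psi> 0 < 2 * pi" "separated_zeros m \<psi> c h"
proof -
  obtain \<eta> where \<eta>: "zpoly m \<eta> = zpoly m \<phi>" "\<And>j. j < m \<Longrightarrow> 0 \<le> \<eta> j" "\<And>j. j < m \<Longrightarrow> \<eta> j < 2 * pi"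
    "\<And>i j. i \<le> j \<Longrightarrow> j < m \<Longrightarrow> \<eta> i \<le> \<eta> j" using zpoly_sorted by metis
  define \<psi> where "\<psi> = \<eta>(m := \<eta> 0 + 2 * pi)"
  have \<psi>m: "\<psi> m = \<psi> 0 + 2 * pi" using m by (simp add: \<psi>_def)
  have \<psi>j: "\<psi> j = \<eta> j" if "j < m" for j using that by (simp add: \<psi>_def)
  have eq: "zpoly m \<psi> = zpoly m \<phi>" unfolding \<eta>(1)[symmetric] by (rule zpoly_cong) (simp add: \<psi>j)
  have not_less: "\<not> measure lebesgue (superlevel (zpoly m \<xi>) h) < measure lebesgue (superlevel (zpoly m \<psi>) h)" for \<xi>
    using delta_le[of m h \<xi>] min eq by simp
  obtain t0 where t0: "h < zmod m \<psi> t0" using zmod_ge_2[OF m, of \<psi>] h(2) by (meson less_le_trans)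
  have zero: "zmod m \<psi> (\<psi> j) = 0" if "j \<le> m" for j
    using zmod_zero[of j m \<psi>] zmod_zero[of 0 m \<psi>] zmod_periodic1[of m \<psi> "\<psi> 0"] \<psi>m m that
    by (cases "j = m") auto
  have "\<exists>t. \<psi> j \<le> t \<and> t \<le> \<psi> (Suc j) \<and> h \<le> zmod m \<psi> t" if j: "j < m" for j
  proof (rule ccontr)
    assume "\<not> ?thesis"
    then have low: "zmod m \<psi> t < h" if "\<psi> j \<le> t" "t \<le> \<psi> (Suc j)" for t using that by force
    \<comment> \<open>Displacement requires the two zeros to be less than a turn apart. A low gap of
      full length would put |P| below h on the whole circle, which the value at \<open>t0\<close>
      excludes.\<close>
    have not_full: "\<psi> (Suc j) \<noteq> \<psi> j + 2 * pi"
    proof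
      assume full: "\<psi> (Suc j) = \<psi> j + 2 * pi"
      obtain k :: int where "\<psi> j \<le> t0 + 2 * pi * of_int k" "t0 + 2 * pi * of_int k < \<psi> j + 2 * pi"
        by (rule shift_to_window)
      then show False
        using low[of "t0 + 2 * pi * of_int k"] t0 full by (simp add: zmod_periodic)
    qed
    show False
    proof (cases "Suc j < m")
      case True
      have "\<psi> j \<le> \<psi> (Suc j)" "\<psi> (Suc j) < \<psi> j + 2 * pi"
        using \<eta>(2)[OF j] \<eta>(3)[OF True] \<eta>(4)[of j "Suc j"] True by (auto simp: \<psi>j)
      from move_zeros_apart[OF j True _ this h(1) low t0] not_less show False by auto
    next
      case False
      then have Suc: "Suc j = m" using j by simp
      have j0: "j \<noteq> 0" using not_full \<psi>m Suc by (intro notI) auto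
      \<comment> \<open>The last gap wraps around, so the first zero is represented one turn later,
        to the right of the last one.\<close>
      define \<xi> where "\<xi> = \<psi>(0 := \<psi> 0 + 2 * pi)"
      have "cis (\<psi> 0 + 2 * pi) = cis (\<psi> 0)" using cis_periodic_int[of "\<psi> 0" 1] by simp
      then have \<xi>: "zpoly m \<xi> = zpoly m \<psi>" by (intro zpoly_cong) (auto simp: \<xi>_def)
      have ends: "\<xi> j = \<psi> j" "\<xi> 0 = \<psi> (Suc j)" using j0 Suc \<psi>m by (auto simp: \<xi>_def)
      have "\<eta> 0 \<le> \<eta> j" "\<eta> j < 2 * pi" "0 \<le> \<eta> 0" using \<eta>(2)[of 0] \<eta>(3)[OF j] \<eta>(4)[of 0 j] j by auto
      then have le: "\<xi> j \<le> \<xi> 0" "\<xi> 0 \<le> \<xi> j + 2 * pi"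
        unfolding ends Suc \<psi>m using j m by (auto simp: \<psi>j)
      then have less: "\<xi> 0 < \<xi> j + 2 * pi" using not_full unfolding ends by simp
      have "\<exists>\<psi>'. measure lebesgue (superlevel (zpoly m \<psi>') h) < measure lebesgue (superlevel (zpoly m \<xi>) h)"
        by (rule move_zeros_apart[OF j _ j0 le(1) less h(1), of t0])
          (use low t0 m in \<open>auto simp: ends zmod_cong[OF \<xi>]\<close>)
      then show False using not_less \<xi> by auto
    qed
  qed
  then obtain c where c: "\<And>j. j < m \<Longrightarrow> \<psi> j \<le> c j" "\<And>j. j < m \<Longrightarrow> c j \<le> \<psi> (Suc j)" "\<And>j. j < m \<Longrightarrow> h \<le> zmod m \<psi> (c j)"
    by metis
  have "separated_zeros m \<psi> c h"
  proof
    show "\<psi> j < c j" if "j < m" for j using c[OF that] zero[of j] that h by (auto simp: less_le)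
    show "c j < \<psi> (Suc j)" if "j < m" for j using c[OF that] zero[of "Suc j"] that h by (auto simp: less_le)
  qed (use m h \<psi>m c in auto)
  then show thesis using that eq \<eta>(2,3)[of 0] m by (simp add: \<psi>j)
qed

section \<open>The superlevel set in a window starting at a zero\<close>

context separated_zeros
begin

lemma window_gap:
  assumes "\<phi> 0 \<le> t" "t < \<phi> 0 + 2 * pi"
  shows "\<exists>j<m. \<phi> j \<le> t \<and> t \<le> \<phi> (Suc j)"
proof -
  define n where "n = (LEAST n. t < \<phi> n)"
  have n: "t < \<phi> n" unfolding n_def by (rule LeastI[of _ m]) (use assms wrap in simp)
  have le: "n \<le> m" unfolding n_def by (rule Least_le) (use assms wrap in simp)
  have "n \<noteq> 0" using n assms(1) by (intro notI) auto
  then obtain j where j: "n = Suc j" by (cases n) auto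
  then have "\<not> t < \<phi> j" using not_less_Least[of j "\<lambda>n. t < \<phi> n"] by (simp add: n_def)
  then show ?thesis using n le j by (intro exI[of _ j]) auto
qed

lemma arcs:
  "\<exists>a b. (\<forall>j<m. \<phi> j < a j \<and> a j \<le> b j \<and> b j < \<phi> (Suc j) \<and> zmod m \<phi> (a j) = h \<and> zmod m \<phi> (b j) = h \<and>
      (\<forall>t. a j < t \<and> t < b j \<longrightarrow> h < zmod m \<phi> t)) \<and>
    (\<forall>t. \<phi> 0 \<le> t \<and> t < \<phi> 0 + 2 * pi \<longrightarrow> (h \<le> zmod m \<phi> t \<longleftrightarrow> (\<exists>j<m. a j \<le> t \<and> t \<le> b j)))"
proof -
  have "\<forall>j. \<exists>a b. j < m \<longrightarrow> \<phi> j < a \<and> a \<le> b \<and> b < \<phi> (Suc j) \<and> zmod m \<phi> a = h \<and> zmod m \<phi> b = h \<and>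
    (\<forall>t. a < t \<and> t < b \<longrightarrow> h < zmod m \<phi> t) \<and>
    (\<forall>t. \<phi> j \<le> t \<and> t \<le> \<phi> (Suc j) \<and> h \<le> zmod m \<phi> t \<longrightarrow> a \<le> t \<and> t \<le> b)"
    using gap_superlevel by blast
  then obtain a b where ab: "\<And>j. j < m \<Longrightarrow> \<phi> j < a j \<and> a j \<le> b j \<and> b j < \<phi> (Suc j) \<and>
      zmod m \<phi> (a j) = h \<and> zmod m \<phi> (b j) = h \<and>
    (\<forall>t. a j < t \<and> t < b j \<longrightarrow> h < zmod m \<phi> t) \<and>
    (\<forall>t. \<phi> j \<le> t \<and> t \<le> \<phi> (Suc j) \<and> h \<le> zmod m \<phi> t \<longrightarrow> a j \<le> t \<and> t \<le> b j)"
    by metis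
  have "h \<le> zmod m \<phi> t \<longleftrightarrow> (\<exists>j<m. a j \<le> t \<and> t \<le> b j)" if t: "\<phi> 0 \<le> t" "t < \<phi> 0 + 2 * pi" for t
  proof
    assume "h \<le> zmod m \<phi> t"
    then show "\<exists>j<m. a j \<le> t \<and> t \<le> b j" using window_gap[OF t] ab by blast
  next
    assume "\<exists>j<m. a j \<le> t \<and> t \<le> b j"
    then obtain j where j: "j < m" "a j \<le> t" "t \<le> b j" by blast
    then consider "t = a j" | "t = b j" | "a j < t \<and> t < b j" by linarith
    then show "h \<le> zmod m \<phi> t" using ab[OF j(1)] by cases auto
  qed
  then show ?thesis using ab by (intro exI[of _ a] exI[of _ b]) simp
qed

end

text \<open>The circle is cut open at a zero of P instead of at 0, so that no segment is cut in two;
  the piece before x moves by one turn.\<close>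

lemma measure_superlevel_window:
  assumes "0 \<le> x" "x < 2 * pi"
  shows "measure lebesgue (superlevel (zpoly m \<phi>) h) = measure lebesgue {t. x \<le> t \<and> t < x + 2 * pi \<and> h \<le> zmod m \<phi> t}"
proof -
  have meas: "{t \<in> {u..<v}. h \<le> zmod m \<phi> t} \<in> lmeasurable" for u v
  proof -
    have "{t. h \<le> zmod m \<phi> t} \<in> sets lebesgue"
      by (auto intro!: borel_closed closed_Collect_le continuous_intros)
    then have "{u..<v} \<inter> {t. h \<le> zmod m \<phi> t} \<in> sets lebesgue" by (intro sets.Int) auto
    moreover have "bounded ({u..<v} \<inter> {t. h \<le> zmod m \<phi> t})" by (rule bounded_subset[of "{u..v}"]) auto
    ultimately have "{u..<v} \<inter> {t. h \<le> zmod m \<phi> t} \<in> lmeasurable" by (rule bounded_set_imp_lmeasurable[rotated])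
    then show ?thesis by (simp add: Int_def)
  qed
  let ?A = "{t \<in> {0..<x}. h \<le> zmod m \<phi> t}" and ?B = "{t \<in> {x..<2 * pi}. h \<le> zmod m \<phi> t}"
  let ?C = "{t \<in> {2 * pi..<x + 2 * pi}. h \<le> zmod m \<phi> t}"
  have C: "?C = (+) (2 * pi) ` ?A"
  proof
    show "?C \<subseteq> (+) (2 * pi) ` ?A"
    proof
      fix t assume t: "t \<in> ?C"
      then have "t - 2 * pi \<in> ?A" using zmod_periodic1[of m \<phi> "t - 2 * pi"] by auto
      then show "t \<in> (+) (2 * pi) ` ?A" by (intro image_eqI[of _ _ "t - 2 * pi"]) auto
    qed
    show "(+) (2 * pi) ` ?A \<subseteq> ?C" using zmod_periodic1[of m \<phi>] by (auto simp: add.commute)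
  qed
  have "superlevel (zpoly m \<phi>) h = ?B \<union> ?A" using assms by (auto simp: superlevel_zpoly)
  moreover have "{t. x \<le> t \<and> t < x + 2 * pi \<and> h \<le> zmod m \<phi> t} = ?B \<union> ?C" using assms by auto
  moreover have "measure lebesgue (?B \<union> ?A) = measure lebesgue ?B + measure lebesgue ?A"
  proof -
    have "?B \<inter> ?A = {}" by auto
    then show ?thesis using measure_Un3[OF meas meas, of x "2 * pi" 0 x] by simp
  qed
  moreover have "measure lebesgue (?B \<union> ?C) = measure lebesgue ?B + measure lebesgue ?C"
  proof -
    have "?B \<inter> ?C = {}" by auto
    then show ?thesis using measure_Un3[OF meas meas, of x "2 * pi" "2 * pi" "x + 2 * pi"] by simp
  qed
  moreover have "measure lebesgue ?C = measure lebesgue ?A" unfolding C by (rule measure_translation)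
  ultimately show ?thesis by simp
qed

lemma int_multiple_small:
  assumes "\<bar>2 * pi * of_int n\<bar> < 2 * pi"
  shows "n = 0"
proof -
  have "\<bar>real_of_int n\<bar> < 1" using assms by (simp add: abs_mult)
  then show ?thesis by linarith
qed

section \<open>Counting the nondegenerate segments of a minimizer\<close>

theorem theorem2:
  fixes m :: nat and h :: real and P :: "complex poly"
  assumes "m \<ge> 1" and "0 < h" and "h < 2"
    and "P \<in> unit_circle_polys m"
    and "measure lebesgue (superlevel P h) = delta m h"
  shows "\<exists>a b F. a < b \<and> b - a < 2*pi \<and> finite F \<and> card F = m - 1
           \<and> F \<subseteq> {0..<2*pi} \<and> F \<inter> circle_arc a b = {}
           \<and> superlevel P h = circle_arc a b \<union> F"
proof -
  note m = assms(1) and h02 = assms(2,3)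
  obtain \<phi>0 where "P = zpoly m \<phi>0" using assms(4) by (auto simp: unit_circle_polys_def zpoly_def)
  then obtain \<phi> c where \<phi>: "P = zpoly m \<phi>" "0 \<le> \<phi> 0" "\<phi> 0 < 2 * pi" "separated_zeros m \<phi> c h"
    using minimizer_separated[OF m h02] assms(5) by metis
  interpret separated_zeros m \<phi> c h by (rule \<phi>(4))
  obtain a b where *: "\<forall>j<m. \<phi> j < a j \<and> a j \<le> b j \<and> b j < \<phi> (Suc j) \<and> zmod m \<phi> (a j) = h \<and> zmod m \<phi> (b j) = h \<and>
      (\<forall>t. a j < t \<and> t < b j \<longrightarrow> h < zmod m \<phi> t)"
    and super: "\<forall>t. \<phi> 0 \<le> t \<and> t < \<phi> 0 + 2 * pi \<longrightarrow> (h \<le> zmod m \<phi> t \<longleftrightarrow> (\<exists>j<m. a j \<le> t \<and> t \<le> b j))"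
    using arcs by metis
  have ab: "\<phi> j < a j" "a j \<le> b j" "b j < \<phi> (Suc j)"
    and lev: "zmod m \<phi> (a j) = h" "zmod m \<phi> (b j) = h"
    and arc: "a j < t \<Longrightarrow> t < b j \<Longrightarrow> h < zmod m \<phi> t" if "j < m" for j t
    using * that by auto
  have super: "h \<le> zmod m \<phi> t \<longleftrightarrow> (\<exists>j<m. a j \<le> t \<and> t \<le> b j)"
    if "\<phi> 0 \<le> t" "t < \<phi> 0 + 2 * pi" for t
    using super that by simp
  have ord: "b i < a j" if "i < j" "j < m" for i j
    using ab(3)[of i] ab(1)[of j] \<phi>_mono[of "Suc i" j] that by auto
  have range: "\<phi> 0 < a j" "b j < \<phi> 0 + 2 * pi" if "j < m" for j
    using ab(1,3)[OF that] \<phi>_mono[of 0 j] \<phi>_mono[of "Suc j" m] that wrap by auto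
  define L where "L = (\<Sum>j<m. b j - a j)"
  define J where "J = {j. j < m \<and> a j < b j}"
  have finJ: "finite J" by (simp add: J_def)
  have LJ: "(\<Sum>j\<in>J. b j - a j) = L"
    unfolding L_def using ab(2) by (intro sum.mono_neutral_left) (force simp: J_def)+
  \<comment> \<open>Strictness of L < 2 pi comes from the free piece between \<open>b 0\<close> and
    the next zero, which is subtracted from the total of all gaps.\<close>
  have "L \<le> (\<Sum>j<m. \<phi> (Suc j) - \<phi> j) - (\<phi> (Suc 0) - b 0)"
  proof -
    have "L \<le> (\<Sum>j<m. (\<phi> (Suc j) - \<phi> j) - (if j = 0 then \<phi> (Suc 0) - b 0 else 0))"
      unfolding L_def
    proof (rule sum_mono)
      fix j assume "j \<in> {..<m}"
      then show "b j - a j \<le> (\<phi> (Suc j) - \<phi> j) - (if j = 0 then \<phi> (Suc 0) - b 0 else 0)"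
        using ab(1)[of j] ab(3)[of j] by auto
    qed
    then show ?thesis using m by (simp add: sum_subtractf)
  qed
  then have L_less: "L < 2 * pi"
    using ab(3)[of 0] m wrap by (simp add: sum_lessThan_telescope)
  have measure: "measure lebesgue (superlevel P h) = L"
  proof -
    have eq: "{t. \<phi> 0 \<le> t \<and> t < \<phi> 0 + 2 * pi \<and> h \<le> zmod m \<phi> t} = (\<Union>j\<in>{..<m}. {a j..b j})"
    proof (intro set_eqI iffI)
      fix t assume "t \<in> {t. \<phi> 0 \<le> t \<and> t < \<phi> 0 + 2 * pi \<and> h \<le> zmod m \<phi> t}"
      then show "t \<in> (\<Union>j\<in>{..<m}. {a j..b j})" using super[of t] by auto
    next
      fix t assume "t \<in> (\<Union>j\<in>{..<m}. {a j..b j})"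
      then obtain j where j: "j < m" "a j \<le> t" "t \<le> b j" by auto
      then have "\<phi> 0 \<le> t" "t < \<phi> 0 + 2 * pi" using range[OF j(1)] by auto
      then show "t \<in> {t. \<phi> 0 \<le> t \<and> t < \<phi> 0 + 2 * pi \<and> h \<le> zmod m \<phi> t}"
        using super[of t] j by auto
    qed
    have disj: "disjoint_family_on (\<lambda>j. {a j..b j}) {..<m}"
      unfolding disjoint_family_on_def
    proof (intro ballI impI)
      fix i j assume ij: "i \<in> {..<m}" "j \<in> {..<m}" "i \<noteq> j"
      then consider "i < j" | "j < i" by linarith
      then have "b i < a j \<or> b j < a i" using ord ij by (metis lessThan_iff)
      then show "{a i..b i} \<inter> {a j..b j} = {}" by auto
    qed
    have "measure lebesgue (\<Union>j\<in>{..<m}. {a j..b j}) = (\<Sum>j<m. measure lebesgue {a j..b j})"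
      by (rule measure_finite_Union) (use disj in \<open>auto simp: ab(2)\<close>)
    also have "\<dots> = L" unfolding L_def by (rule sum.cong) (auto simp: ab(2))
    finally show ?thesis
      unfolding \<phi>(1) measure_superlevel_window[OF \<phi>(2,3)] eq .
  qed
  consider "J = {}" | k where "J = {k}" | "2 \<le> card J"
    using finJ by (metis One_nat_def Suc_1 card_0_eq card_1_singletonE leI less_2_cases)
  then show ?thesis
  proof cases
    case 1
    \<comment> \<open>On degenerate segments |P| equals h, but somewhere it is at least 2, hence
      larger than h.\<close>
    obtain t0 where t0: "h < zmod m \<phi> t0" using zmod_ge_2[OF m, of \<phi>] h02(2) by (meson less_le_trans)
    obtain n :: int where n: "\<phi> 0 \<le> t0 + 2 * pi * of_int n" "t0 + 2 * pi * of_int n < \<phi> 0 + 2 * pi"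
      by (rule shift_to_window)
    define t where "t = t0 + 2 * pi * of_int n"
    have t: "h < zmod m \<phi> t" using t0 by (simp add: t_def zmod_periodic)
    then obtain j where j: "j < m" "a j \<le> t" "t \<le> b j" using super[of t] n t_def by auto
    then have "t = a j" using 1 by (force simp: J_def)
    then show ?thesis using lev(1)[OF j(1)] t by simp
  next
    case (2 k)
    then have k: "k < m" "a k < b k" by (auto simp: J_def)
    have point: "a j = b j" if "j < m" "j \<noteq> k" for j
      using 2 that ab(2)[OF that(1)] by (force simp: J_def)
    \<comment> \<open>The segments live in the window starting at \<open>\<phi> 0\<close>, while the
      claim refers to [0, 2 pi); \<nu> reduces a point to that interval. Each gap other than k
      contributes one point, which gives m - 1.\<close>
    have "\<exists>x. 0 \<le> x \<and> x < 2 * pi \<and> (\<exists>n::int. x = t + 2 * pi * of_int n)" for t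
      using shift_to_window[of 0 t] by (metis add_0)
    then obtain \<nu> where \<nu>: "\<And>t. 0 \<le> \<nu> t" "\<And>t. \<nu> t < 2 * pi" "\<And>t. \<exists>n::int. \<nu> t = t + 2 * pi * of_int n"
      by metis
    define F where "F = (\<lambda>i. \<nu> (a i)) ` ({..<m} - {k})"
    have same: "s = t" if "\<phi> 0 < s" "s < \<phi> 0 + 2 * pi" "\<phi> 0 < t" "t < \<phi> 0 + 2 * pi" "s = t + 2 * pi * of_int n"
      for s t and n :: int
      using int_multiple_small[of n] that by auto
    have aw: "\<phi> 0 < a j" "a j < \<phi> 0 + 2 * pi" if "j < m" for j
      using range[OF that] ab(2)[OF that] by auto
    have "inj_on (\<lambda>i. \<nu> (a i)) ({..<m} - {k})"
    proof (rule inj_onI)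
      fix i j assume ij: "i \<in> {..<m} - {k}" "j \<in> {..<m} - {k}" "\<nu> (a i) = \<nu> (a j)"
      obtain n n' :: int where "\<nu> (a i) = a i + 2 * pi * of_int n" "\<nu> (a j) = a j + 2 * pi * of_int n'"
        using \<nu>(3) by metis
      then have "a i = a j + 2 * pi * of_int (n' - n)" using ij(3) by (simp add: algebra_simps)
      then have "a i = a j" using same aw ij by (metis DiffD1 lessThan_iff)
      then show "i = j" using ord[of i j] ord[of j i] ab(2)[of i] ab(2)[of j] ij
        by (metis DiffD1 lessThan_iff less_irrefl linorder_neqE_nat order_le_less_trans)
    qed
    then have cardF: "card F = m - 1" unfolding F_def using k by (simp add: card_image card_Diff_singleton)
    have disj: "F \<inter> circle_arc (a k) (b k) = {}"
    proof (rule ccontr)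
      assume "\<not> ?thesis"
      then obtain i n where i: "i < m" "i \<noteq> k" and n: "a k \<le> \<nu> (a i) + 2 * pi * of_int n" "\<nu> (a i) + 2 * pi * of_int n \<le> b k"
        by (auto simp: F_def circle_arc_def)
      obtain n' :: int where "\<nu> (a i) = a i + 2 * pi * of_int n'" using \<nu>(3) by metis
      then have s: "\<nu> (a i) + 2 * pi * of_int n = a i + 2 * pi * of_int (n + n')" by (simp add: algebra_simps)
      have "\<nu> (a i) + 2 * pi * of_int n = a i"
        by (rule same[OF _ _ _ _ s]) (use n range[OF k(1)] aw[OF i(1)] in auto)
      then have "a k \<le> a i" "a i \<le> b k" using n by auto
      then show False
        using ord[of i k] ord[of k i] i k ab(2)[OF i(1)] by (metis linorder_neqE_nat not_less order_trans)
    qed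
    have "t \<in> superlevel P h \<longleftrightarrow> t \<in> circle_arc (a k) (b k) \<union> F" for t
    proof (cases "t \<in> {0..<2 * pi}")
      case True
      obtain n :: int where n: "\<phi> 0 \<le> t + 2 * pi * of_int n" "t + 2 * pi * of_int n < \<phi> 0 + 2 * pi"
        by (rule shift_to_window)
      have in_super: "t \<in> superlevel P h \<longleftrightarrow> (\<exists>j<m. a j \<le> t + 2 * pi * of_int n \<and> t + 2 * pi * of_int n \<le> b j)"
        using super[OF n] True by (simp add: \<phi>(1) superlevel_zpoly zmod_periodic)
      show ?thesis
      proof
        assume "t \<in> superlevel P h"
        then obtain j where j: "j < m" "a j \<le> t + 2 * pi * of_int n" "t + 2 * pi * of_int n \<le> b j"
          using in_super by blast
        show "t \<in> circle_arc (a k) (b k) \<union> F"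
        proof (cases "j = k")
          case True
          then show ?thesis using j \<open>t \<in> {0..<2 * pi}\<close> by (auto simp: circle_arc_def)
        next
          case False
          then have tj: "a j = t + 2 * pi * of_int n" using point j by force
          obtain n' :: int where n': "\<nu> (a j) = a j + 2 * pi * of_int n'" using \<nu>(3) by metis
          then have d: "\<nu> (a j) - t = 2 * pi * of_int (n + n')" using tj by (simp add: algebra_simps)
          moreover have "\<bar>\<nu> (a j) - t\<bar> < 2 * pi"
            using \<nu>(1,2)[of "a j"] \<open>t \<in> {0..<2 * pi}\<close> by auto
          ultimately have "n + n' = 0" using int_multiple_small[of "n + n'"] by metis
          then have "\<nu> (a j) = t" using d by simp
          then show ?thesis using j(1) False by (auto simp: F_def)
        qed
      next
        assume "t \<in> circle_arc (a k) (b k) \<union> F"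
        then have "\<exists>j<m. \<exists>l::int. a j \<le> t + 2 * pi * of_int l \<and> t + 2 * pi * of_int l \<le> b j"
        proof
          assume "t \<in> circle_arc (a k) (b k)"
          then show ?thesis using k by (auto simp: circle_arc_def)
        next
          assume "t \<in> F"
          then obtain i where i: "i < m" "t = \<nu> (a i)" by (auto simp: F_def)
          obtain n' :: int where "\<nu> (a i) = a i + 2 * pi * of_int n'" using \<nu>(3) by metis
          then have "t + 2 * pi * of_int (- n') = a i" using i by simp
          then show ?thesis using i ab(2)[OF i(1)] by (metis order_refl)
        qed
        then obtain j l where j: "j < m" and l: "a j \<le> t + 2 * pi * of_int l" "t + 2 * pi * of_int l \<le> b j" by blast
        have "h \<le> zmod m \<phi> (t + 2 * pi * of_int l)"
          by (subst super) (use j l range[OF j] in auto)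
        then show "t \<in> superlevel P h" using True by (simp add: \<phi>(1) superlevel_zpoly zmod_periodic)
      qed
    next
      case False
      then show ?thesis using \<nu>(1,2) by (auto simp: superlevel_def circle_arc_def F_def)
    qed
    then have "superlevel P h = circle_arc (a k) (b k) \<union> F" by blast
    moreover have "b k - a k < 2 * pi" using range[OF k(1)] by simp
    moreover have "finite F" "F \<subseteq> {0..<2 * pi}" using \<nu>(1,2) by (auto simp: F_def)
    ultimately show ?thesis using k(2) cardF disj by blast
  next
    case 3
    interpret AS: arc_system J a b
    proof
      show "J \<noteq> {}" using 3 by auto
      show "b i - a j < 2 * pi" if "i \<in> J" "j \<in> J" for i j
        using range[of i] range[of j] that by (auto simp: J_def)
      show "(\<Sum>j\<in>J. b j - a j) < 2 * pi" using LJ L_less by simp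
    qed (use finJ ord in \<open>auto simp: J_def\<close>)
    have L: "AS.L = L" unfolding AS.L_def LJ ..
    obtain k where k: "cmod k = 1"
      "\<And>z. cmod z = 1 \<Longrightarrow> (poly (smult k (zpoly m \<phi>)) z)\<^sup>2 = z ^ m * of_real ((cmod (poly (smult k (zpoly m \<phi>)) z))\<^sup>2)"
      using zpoly_normalized by blast
    define p where "p = smult k (zpoly m \<phi>)"
    have k0: "k \<noteq> 0" using k(1) by auto
    have norm_p: "cmod (poly p z) = cmod (poly (zpoly m \<phi>) z)" for z
      using k(1) by (simp add: p_def norm_mult)
    have pz: "cmod (poly p (cis t)) = zmod m \<phi> t" for t
      by (simp add: norm_p zmod_def)
    have p0: "cmod (poly p 0) = 1"
      by (simp add: norm_p poly_zpoly prod_norm[symmetric])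
    have degp: "degree p \<le> m"
      unfolding p_def zpoly_def by (rule order_trans[OF degree_smult_le], subst degree_prod_eq_sum_degree) auto
    have "2 * cos (AS.L / 4) ^ m < h"
    proof (rule AS.several_arcs_bound[of m h p])
      show "Re (z * poly (pderiv p) z / poly p z) = m / 2" if "cmod z = 1" "poly p z \<noteq> 0" for z
        using zpoly_log_derivative[of z m \<phi>] that k0 by (simp add: p_def pderiv_smult)
      show "(poly p z)\<^sup>2 \<noteq> of_real (h\<^sup>2) * z ^ m" if "cmod z < 1" for z
        by (rule no_level_in_disc[OF degp _ _ pz that]) (use p0 k(2) in \<open>auto simp: p_def\<close>)
      show "\<exists>k\<in>J. \<exists>t. a k < t \<and> t < b k \<and> z = cis t" if z: "cmod z = 1" "h < cmod (poly p z)" for z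
      proof -
        obtain n :: int where n: "\<phi> 0 \<le> Arg z + 2 * pi * of_int n" "Arg z + 2 * pi * of_int n < \<phi> 0 + 2 * pi"
          by (rule shift_to_window)
        define t where "t = Arg z + 2 * pi * of_int n"
        have "cis (Arg z) = z" using z(1) by (metis cis_Arg div_by_1 norm_zero of_real_1 sgn_eq zero_neq_one)
        then have zt: "z = cis t" by (simp add: t_def cis_periodic_int)
        then have ht: "h < zmod m \<phi> t" using z pz by simp
        then obtain j where j: "j < m" "a j \<le> t" "t \<le> b j" using super[of t] n by (auto simp: t_def)
        then have "t \<noteq> a j" "t \<noteq> b j" using lev(1)[OF j(1)] lev(2)[OF j(1)] ht by auto
        then show ?thesis using j zt by (intro bexI[of _ j] exI[of _ t]) (auto simp: J_def)
      qed
    qed (use 3 m h02 k(2) p0 arc pz in \<open>auto simp: p_def J_def\<close>)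
    \<comment> \<open>Minimality bounds L by the measure for the Chebyshev-type polynomial, and the
      cosine reverses the inequality. The m-th power then contradicts the strict bound for several
      arcs.\<close>
    moreover have "root m (h / 2) \<le> cos (L / 4)"
    proof -
      have r: "\<bar>root m (h / 2)\<bar> \<le> 1" using m h02 by simp
      have "L \<le> 4 * arccos (root m (h / 2))"
        using cheb_measure[OF m h02] delta_le[of m h] assms(5) unfolding measure by (meson order_trans)
      then have "cos (arccos (root m (h / 2))) \<le> cos (L / 4)"
        using AS.L_pos r unfolding L by (intro cos_monotone_0_pi_le) (auto simp: arccos_ubound abs_le_iff)
      then show ?thesis using r by (simp add: cos_arccos_abs)
    qed
    then have "root m (h / 2) ^ m \<le> cos (L / 4) ^ m"
      by (rule power_mono) (use m h02 in simp)
    ultimately show ?thesis using m h02 unfolding L by simp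
  qed
qed

end
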